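(* Let $K\subset H$ be a convex body in a real Hilbert space $H$. Assume that $\mathbf{c}\in K$ with $B(\mathbf{c},r)\subset K\subset B(\mathbf{c},R)$, where $0<r<R<\infty$. Assume also that with certain parameters $0<\tau<2r$ and $0<\varphi<2\arcsin\big(r/(4\sqrt2R)\big)$ the modulus of continuity of the multivalued outer unit normal vector function $\mathbf{n}$ of $K$ satisfies $\omega(\mathbf{n},\tau)\le\varphi$. Then for any boundary point $\mathbf{x}\in\partial K$, any outer unit normal vector $\mathbf{u}\in\mathbf{n}(\mathbf{x})$ and any two-dimensional affine plane $P$ passing through $\mathbf{x}$ and $\mathbf{c}$, the orthogonal projection $\Pi_P\mathbf{u}$ of the vector $\mathbf{u}$ to $P$ does not vanish, so that $\mathbf{w}:=\Pi_P\mathbf{u}/|\Pi_P\mathbf{u}|$ is well-defined. Moreover, taking an arbitrary (Cartesian) coordinate system in $P$ and putting $\alpha:=\arg(\mathbf{w})+\pi/2 \bmod 2\pi$ with respect to this coordinate system, we have $$M(\mathbf{x},\alpha,\Phi,\tau)\subset K,\qquad\text{where}\quad \Phi=2\arcsin\Big(\frac{2R}{r}\sin\frac{\varphi}{2}\Big),$$ the mangled polygon $M(\mathbf{x},\alpha,\Phi,\tau)$ being taken in $P$ with respect to the chosen coordinate system.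
   Context: A convex body is a bounded closed convex set with nonempty interior; $B(\mathbf{c},r)$ is the closed ball of centre $\mathbf{c}$ and radius $r$. For $\mathbf{x}\in\partial K$, $\mathbf{n}(\mathbf{x})$ is the nonempty set of all outer unit normals of $K$ at $\mathbf{x}$, i.e. unit vectors $\mathbf{u}$ with $\langle\mathbf{y}-\mathbf{x},\mathbf{u}\rangle\le0$ for all $\mathbf{y}\in K$. The modulus of continuity is $$\omega(\mathbf{n},\tau):=\sup\{\arccos\langle\mathbf{u},\mathbf{w}\rangle:\ \mathbf{x},\mathbf{y}\in\partial K,\ |\mathbf{x}-\mathbf{y}|\le\tau,\ \mathbf{u}\in\mathbf{n}(\mathbf{x}),\ \mathbf{w}\in\mathbf{n}(\mathbf{y})\}.$$ $\Pi_P$ applied to a vector means orthogonal projection onto the linear direction space of the affine plane $P$. Mangled $n$-gons. For $k\in\mathbb{N}$, $k\ge2$, put $\varphi^*:=\frac{\pi}{2k}$ and, for $m\in\{1,\dots,4k\}\setminus\{k,2k,3k,4k\}$, $$A_m:=\Big(\sum_{j=1}^m\cos(j\varphi^* )-\sum_{\ell=1}^{\lfloor m/k\rfloor}\cos(\ell k\varphi^* ),\ \sum_{j=1}^m\sin(j\varphi^* )-\sum_{\ell=1}^{\lfloor m/k\rfloor}\sin(\ell k\varphi^* )\Big)\in\mathbb{R}^2.$$ $M_k$ is the convex hull of all these points $A_m$. For $\tau>0$, $\alpha\in\mathbb{R}$, $\mathbf{x}\in\mathbb{R}^2$, $\Phi\in(0,\pi/4]$, with $k:=\lfloor\frac{\pi}{2\Phi}\rfloor$,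 define $M(\mathbf{x},\alpha,\Phi,\tau):=U_\alpha(\tau M_k)+\mathbf{x}$, where $U_\alpha$ is the counterclockwise rotation of $\mathbb{R}^2$ about the origin by angle $\alpha$. *)

theory Defs
  imports "HOL-Analysis.Analysis" "HOL-Library.Real_Mod"
begin

definition convex_body :: "'a::real_normed_vector set \<Rightarrow> bool" where
  "convex_body K \<longleftrightarrow> bounded K \<and> closed K \<and> convex K \<and> interior K \<noteq> {}"

definition outer_normals :: "'a::real_inner set \<Rightarrow> 'a \<Rightarrow> 'a set" where
  "outer_normals K x = {u. norm u = 1 \<and> (\<forall>y\<in>K. (y - x) \<bullet> u \<le> 0)}"

(* The set of angles is contained in [0, pi], so the real-valued Sup is the intended supremum
   whenever some boundary point has an outer normal (Sup {} is unspecified). *)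
definition normal_modulus :: "'a::real_inner set \<Rightarrow> real \<Rightarrow> real" where
  "normal_modulus K \<tau> =
     Sup {arccos (u \<bullet> w) | u w x y.
            x \<in> frontier K \<and> y \<in> frontier K \<and> dist x y \<le> \<tau> \<and>
            u \<in> outer_normals K x \<and> w \<in> outer_normals K y}"

definition direction_space :: "'a::real_vector set \<Rightarrow> 'a set" where
  "direction_space P = {p - q | p q. p \<in> P \<and> q \<in> P}"

(* aff_dim is only available for Euclidean spaces; dim is 0 for infinite-dimensional subspaces
   (and for the empty set), so the value 2 also guarantees that P is nonempty. *)
definition affine_plane :: "'a::real_vector set \<Rightarrow> bool" where
  "affine_plane P \<longleftrightarrow> affine P \<and> dim (direction_space P) = 2"

definition orth_proj :: "'a::real_inner set \<Rightarrow> 'a \<Rightarrow> 'a" where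
  "orth_proj S u = (THE v. v \<in> S \<and> (\<forall>s\<in>S. orthogonal (u - v) s))"

lemma orth_proj_eq:
  assumes "subspace S" "v \<in> S" "\<And>s. s \<in> S \<Longrightarrow> orthogonal (u - v) s"
  shows "orth_proj S u = v"
  unfolding orth_proj_def
proof (rule the_equality)
  fix v' assume v': "v' \<in> S \<and> (\<forall>s\<in>S. orthogonal (u - v') s)"
  have "v' - v \<in> S" using assms v' by (simp add: subspace_diff)
  then have "(u - v) \<bullet> (v' - v) = 0" "(u - v') \<bullet> (v' - v) = 0"
    using assms(3) v' by (auto simp: orthogonal_def)
  then have "(v' - v) \<bullet> (v' - v) = 0" by (simp add: inner_diff_left)
  then show "v' = v" by simp
qed (use assms in auto)

(* Cartesian coordinate systems of the plane P, of either orientation: origin b and orthonormal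
   basis e1, e2 of the direction space. *)
definition cartesian_system :: "'a::real_inner set \<Rightarrow> 'a \<Rightarrow> 'a \<Rightarrow> 'a \<Rightarrow> bool" where
  "cartesian_system P b e1 e2 \<longleftrightarrow>
     b \<in> P \<and> e1 \<in> direction_space P \<and> e2 \<in> direction_space P \<and>
     norm e1 = 1 \<and> norm e2 = 1 \<and> orthogonal e1 e2"

(* The coordinate plane R^2 is modelled by the type complex: Complex a b is the point (a, b),
   Arg is the polar angle and multiplication by cis \<alpha> is the counterclockwise rotation by \<alpha>. *)

definition vec_coords :: "'a::real_inner \<Rightarrow> 'a \<Rightarrow> 'a \<Rightarrow> complex" where
  "vec_coords e1 e2 v = Complex (v \<bullet> e1) (v \<bullet> e2)"

definition point_coords :: "'a::real_inner \<Rightarrow> 'a \<Rightarrow> 'a \<Rightarrow> 'a \<Rightarrow> complex" where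
  "point_coords b e1 e2 p = vec_coords e1 e2 (p - b)"

definition coords_point :: "'a::real_inner \<Rightarrow> 'a \<Rightarrow> 'a \<Rightarrow> complex \<Rightarrow> 'a" where
  "coords_point b e1 e2 z = b + Re z *\<^sub>R e1 + Im z *\<^sub>R e2"

definition mangled_vertex :: "nat \<Rightarrow> nat \<Rightarrow> complex" where
  "mangled_vertex k m =
     (let \<phi> = pi / (2 * real k) in
      Complex ((\<Sum>j = 1..m. cos (real j * \<phi>)) - (\<Sum>l = 1..m div k. cos (real l * real k * \<phi>)))
              ((\<Sum>j = 1..m. sin (real j * \<phi>)) - (\<Sum>l = 1..m div k. sin (real l * real k * \<phi>))))"

definition mangled_polygon0 :: "nat \<Rightarrow> complex set" where
  "mangled_polygon0 k = convex hull (mangled_vertex k ` ({1..4*k} - {k, 2*k, 3*k, 4*k}))"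

definition mangled_polygon :: "complex \<Rightarrow> real \<Rightarrow> real \<Rightarrow> real \<Rightarrow> complex set" where
  "mangled_polygon x \<alpha> \<Phi> \<tau> =
     (\<lambda>p. cis \<alpha> * (\<tau> *\<^sub>R p) + x) ` mangled_polygon0 (nat \<lfloor>pi / (2 * \<Phi>)\<rfloor>)"

end

(*
  Put \<psi> = pi/(2k) (the angle written phi-star in the paper) and let Y(\<theta>) be a point of the planar
  section at which the tangent direction is \<theta>, with Y(0) = x. If any two such points at tangent angles
  \<theta>, \<theta> + \<psi> are at distance at least \<tau>, then
  Y(j \<psi> + \<psi>) - Y(j \<psi>) is a vector of length at least \<tau> whose direction lies between j \<psi> and
  (j + 1) \<psi>. Adding the heights of these vectors over the supporting line at Y(\<theta>) shows that this line
  does not cut the mangled polygon; no parametrisation of the boundary curve is needed.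

  The distance bound comes from the modulus of continuity. Instead of extending a normal of the planar
  section to a normal of K by the Hahn-Banach theorem, a line parallel to the supporting line and slightly
  outside K is separated from K by a nearest-point argument, which gives normals of K at points near the
  plane whose projections have the prescribed direction. Such a projection has length greater than
  r/(2R), because c + r u lies in K for every unit normal u; so an angle between the projections is
  controlled by the angle between the normals.
*)
theory Submission
  imports Defs
begin

section \<open>Vertices of the mangled polygon\<close>

text \<open>The terms subtracted in \<open>mangled_vertex\<close> are the unit vectors whose index
  is a multiple of \<open>k\<close>. Setting these to 0 makes the vertices partial sums of edges,
  and a vertex whose index is a positive multiple of \<open>k\<close> repeats its
  predecessor.\<close>

definition mangled_edge :: "nat \<Rightarrow> nat \<Rightarrow> complex" where
  "mangled_edge k j = (if k dvd j then 0 else cis (real j * (pi / (2 * real k))))"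

lemma mangled_vertex_eq_sum:
  assumes "0 < k"
  shows "mangled_vertex k n = (\<Sum>j = 1..n. mangled_edge k j)"
proof (induction n)
  case 0
  then show ?case by (simp add: mangled_vertex_def Let_def complex_eq_iff)
next
  case (Suc n)
  define \<phi> where "\<phi> = pi / (2 * real k)"
  \<comment> \<open>The subtracted sum gains a term exactly when \<open>k\<close> divides
    \<open>Suc n\<close>; this equation makes the angle of that term equal to the new one of the
    main sum, so the two cancel.\<close>
  have "real (Suc (n div k)) * real k = real (Suc n)" if "k dvd Suc n"
    using that by (metis dvd_div_mult_self of_nat_mult div_Suc mod_eq_0_iff_dvd)
  then have "mangled_vertex k (Suc n) = mangled_vertex k n + mangled_edge k (Suc n)"
    using assms unfolding mangled_vertex_def mangled_edge_def Let_def \<phi>_def[symmetric]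
    by (auto simp: complex_eq_iff div_Suc mod_eq_0_iff_dvd simp del: of_nat_Suc)
  then show ?case using Suc by simp
qed

section \<open>Symmetries of the edge and vertex sequences\<close>

lemma mangled_edge_antiperiodic:
  assumes "0 < k"
  shows "mangled_edge k (j + 2 * k) = - mangled_edge k j"
proof -
  have "real (j + 2 * k) * (pi / (2 * real k)) = real j * (pi / (2 * real k)) + pi"
    using assms by (simp add: field_simps)
  moreover have "k dvd j + 2 * k \<longleftrightarrow> k dvd j"
    by (metis dvd_add_left_iff dvd_triv_right)
  ultimately show ?thesis
    by (simp add: mangled_edge_def complex_eq_iff)
qed

lemma mangled_edge_cnj:
  assumes "0 < k" "j \<le> 4 * k"
  shows "mangled_edge k (4 * k - j) = cnj (mangled_edge k j)"
proof -
  have "real (4 * k - j) * (pi / (2 * real k)) = 2 * pi - real j * (pi / (2 * real k))"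
    using assms by (simp add: field_simps of_nat_diff)
  moreover have "k dvd 4 * k - j \<longleftrightarrow> k dvd j"
    using assms(2) by (metis dvd_diff_nat diff_diff_cancel dvd_triv_right)
  ultimately show ?thesis
    by (simp add: mangled_edge_def complex_eq_iff cos_diff sin_diff)
qed

text \<open>The last \<open>t\<close> terms are the negatives of the first \<open>t\<close>, so only
  the middle survives. This shortens a sum running over more than half a turn to one over at most
  half a turn, where all heights have one sign.\<close>

lemma sum_antiperiodic:
  fixes f :: "nat \<Rightarrow> 'a::ab_group_add"
  assumes "\<And>j. f (j + p) = - f j" and "t \<le> p"
  shows "(\<Sum>j = m + 1..m + p + t. f j) = (\<Sum>j = m + t + 1..m + p. f j)"
proof -
  have "(\<Sum>j = m + 1..m + p + t. f j) = (\<Sum>j = m + 1..m + t. f j) + (\<Sum>j = m + t + 1..m + p. f j)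
      + (\<Sum>j = m + p + 1..m + p + t. f j)"
    using assms(2) sum.ub_add_nat[of "m+1" "m+t" f "p-t"] sum.ub_add_nat[of "m+1" "m+p" f t]
    by simp
  also have "(\<Sum>j = m + p + 1..m + p + t. f j) = (\<Sum>j = m + 1..m + t. f (j + p))"
    using sum.shift_bounds_cl_nat_ivl[of f "m+1" p "m+t"] by (simp add: ac_simps)
  also have "\<dots> = - (\<Sum>j = m + 1..m + t. f j)"
    using assms(1) by (simp add: sum_negf)
  finally show ?thesis by simp
qed

lemma mangled_vertex_periodic:
  assumes "0 < k"
  shows "mangled_vertex k (n + 4 * k) = mangled_vertex k n"
proof -
  \<comment> \<open>With overshoot equal to the half period the remaining index range is empty, so a
    full turn of edges sums to 0.\<close>
  have "(\<Sum>j = n + 1..n + 2 * k + 2 * k. mangled_edge k j)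
      = (\<Sum>j = n + 2 * k + 1..n + 2 * k. mangled_edge k j)"
    using mangled_edge_antiperiodic[OF assms] by (rule sum_antiperiodic) simp
  moreover have "n + 2 * k + 2 * k = n + 4 * k" by simp
  ultimately have "(\<Sum>j = n + 1..n + 4 * k. mangled_edge k j) = 0" by simp
  then show ?thesis
    using sum.ub_add_nat[of 1 n "mangled_edge k" "4 * k"] by (simp add: mangled_vertex_eq_sum[OF assms])
qed

text \<open>The edges sum to 0 over a full turn, and the last \<open>n\<close> of the first
  \<open>4 * k - 1\<close> edges are conjugate to the first \<open>n\<close>. The offset 1 arises
  because the edge with index \<open>4 * k\<close> is 0. This mirror symmetry later reduces negative
  angles to positive ones.\<close>

lemma mangled_vertex_reflect:
  assumes "0 < k" "n < 4 * k"
  shows "mangled_vertex k (4 * k - 1 - n) = - cnj (mangled_vertex k n)"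
proof -
  have "mangled_vertex k (4 * k) = 0"
    using mangled_vertex_periodic[OF assms(1), of 0] by (simp add: mangled_vertex_eq_sum[OF assms(1)])
  moreover have "mangled_edge k (4 * k) = 0" by (simp add: mangled_edge_def)
  moreover have "mangled_vertex k (4 * k) = mangled_vertex k (4 * k - 1) + mangled_edge k (4 * k)"
    using assms(1) sum.nat_ivl_Suc'[of 1 "4 * k - 1" "mangled_edge k"]
    by (simp add: mangled_vertex_eq_sum)
  ultimately have 0: "mangled_vertex k (4 * k - 1) = 0" by simp
  have "mangled_vertex k (4 * k - 1)
      = mangled_vertex k (4 * k - 1 - n) + (\<Sum>j = 4 * k - n..4 * k - 1. mangled_edge k j)"
    using sum.ub_add_nat[of 1 "4 * k - 1 - n" "mangled_edge k" n] assms
    by (simp add: mangled_vertex_eq_sum Suc_diff_Suc)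
  also have "(\<Sum>j = 4 * k - n..4 * k - 1. mangled_edge k j) = (\<Sum>j = 1..n. mangled_edge k (4 * k - j))"
    using assms(2) by (intro sum.reindex_bij_witness[of _ "\<lambda>j. 4 * k - j" "\<lambda>j. 4 * k - j"]) auto
  also have "\<dots> = (\<Sum>j = 1..n. cnj (mangled_edge k j))"
    using assms by (intro sum.cong) (auto simp: mangled_edge_cnj)
  finally show ?thesis
    using 0 by (simp add: mangled_vertex_eq_sum[OF assms(1)] cnj_sum eq_neg_iff_add_eq_0)
qed

section \<open>Heights of vertices over a line of direction \<theta>, and sums of sines\<close>

lemma Im_mangled_edge_cis:
  "Im (mangled_edge k j * cis (- \<theta>))
     = (if k dvd j then 0 else sin (real j * (pi / (2 * real k)) - \<theta>))"
  by (simp add: mangled_edge_def sin_diff)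

text \<open>\<open>Im (z * cis (- \<theta>))\<close> is the height of \<open>z\<close> over the line
  of direction \<theta> through 0. After index \<open>m\<close> the next \<open>2 * k\<close> edges
  make an angle between 0 and \<open>pi\<close> with this line, hence never descend; after that,
  each edge undoes an earlier rise.\<close>

lemma mangled_vertex_minimal:
  assumes "0 < k" and m: "real m * (pi / (2 * real k)) \<le> \<theta>" "\<theta> < real (Suc m) * (pi / (2 * real k))"
    and "m \<le> 4 * k" "n \<le> 4 * k"
  shows "Im (mangled_vertex k m * cis (- \<theta>)) \<le> Im (mangled_vertex k n * cis (- \<theta>))"
proof -
  have edge: "0 \<le> Im (mangled_edge k j * cis (- \<theta>))" if "m < j" "j \<le> m + 2 * k" for j
  proof -
    have "real (Suc m) * (pi / (2 * real k)) \<le> real j * (pi / (2 * real k))"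
         "real j * (pi / (2 * real k)) \<le> real (m + 2 * k) * (pi / (2 * real k))"
      using that by (intro mult_right_mono; simp)+
    moreover have "real (m + 2 * k) * (pi / (2 * real k)) = real m * (pi / (2 * real k)) + pi"
      using assms(1) by (simp add: field_simps)
    ultimately show ?thesis
      using m unfolding Im_mangled_edge_cis by (auto intro!: sin_ge_zero)
  qed
  have *: "Im (mangled_vertex k m * cis (- \<theta>)) \<le> Im (mangled_vertex k (m + d) * cis (- \<theta>))"
    if "d \<le> 4 * k" for d
  proof -
    have "mangled_vertex k (m + d) = mangled_vertex k m + (\<Sum>j = m + 1..m + d. mangled_edge k j)"
      using sum.ub_add_nat[of 1 m "mangled_edge k" d] by (simp add: mangled_vertex_eq_sum[OF assms(1)])
    moreover have "0 \<le> Im ((\<Sum>j = m + 1..m + d. mangled_edge k j) * cis (- \<theta>))"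
    proof (cases "d \<le> 2 * k")
      case True
      then show ?thesis
        unfolding sum_distrib_right Im_sum by (intro sum_nonneg edge) auto
    next
      case False
      \<comment> \<open>Beyond half a turn the descending edges cancel the first \<open>t\<close>
        ascending ones, leaving a sum of ascending edges only.\<close>
      then obtain t where t: "d = 2 * k + t" by (metis le_Suc_ex nat_le_linear)
      have "(\<Sum>j = m + 1..m + 2 * k + t. mangled_edge k j) = (\<Sum>j = m + t + 1..m + 2 * k. mangled_edge k j)"
        using mangled_edge_antiperiodic[OF assms(1)] that t by (intro sum_antiperiodic) auto
      then show ?thesis
        unfolding t add.assoc[symmetric] by (simp only: sum_distrib_right Im_sum) (intro sum_nonneg edge; simp)
    qed
    ultimately show ?thesis by (simp add: distrib_right)
  qed
  show ?thesis
  proof (cases "m \<le> n")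
    case True
    then show ?thesis using *[of "n - m"] assms(5) by simp
  next
    case False
    \<comment> \<open>A vertex with smaller index is reached by running forward through the end of
      the period.\<close>
    then show ?thesis
      using *[of "n + 4 * k - m"] assms(4) mangled_vertex_periodic[OF assms(1), of n] by simp
  qed
qed

(* A unimodal sequence loses only its largest term when neighbours are replaced by their minimum. *)
lemma sum_min_sin_ge:
  fixes \<theta> \<phi> :: real
  assumes "0 \<le> \<phi>" "\<theta> \<le> pi" "real m * \<phi> \<le> \<theta>"
  shows "(\<Sum>j<m. min (sin (\<theta> - real j * \<phi>)) (sin (\<theta> - real (Suc j) * \<phi>)))
           \<ge> (\<Sum>j\<le>m. sin (\<theta> - real j * \<phi>)) - 1"
  using assms(3)
proof (induction m)
  case 0
  then show ?case by simp
next
  case (Suc m)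
  have mono: "real i * \<phi> \<le> real j * \<phi>" if "i \<le> j" for i j
    using that assms(1) by (simp add: mult_right_mono)
  have IH: "(\<Sum>j<m. min (sin (\<theta> - real j * \<phi>)) (sin (\<theta> - real (Suc j) * \<phi>)))
           \<ge> (\<Sum>j\<le>m. sin (\<theta> - real j * \<phi>)) - 1"
    using Suc mono[of m "Suc m"] by simp
  show ?case
  proof (cases "\<theta> - real m * \<phi> \<le> pi / 2")
    case True
    \<comment> \<open>The arguments have already dropped to \<open>pi / 2\<close> or below, so the
      sines decrease and the new minimum is exactly the new term.\<close>
    then have "sin (\<theta> - real (Suc m) * \<phi>) \<le> sin (\<theta> - real m * \<phi>)"
      using Suc.prems mono[of m "Suc m"] pi_gt_zero by (intro sin_monotone_2pi_le) linarith+
    then show ?thesis using IH by simp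
  next
    case False
    \<comment> \<open>All arguments so far exceed \<open>pi / 2\<close>, so the sines have been
      increasing and each minimum is its first entry.\<close>
    have "min (sin (\<theta> - real j * \<phi>)) (sin (\<theta> - real (Suc j) * \<phi>)) = sin (\<theta> - real j * \<phi>)"
      if "j < m" for j
    proof -
      have "sin (pi - (\<theta> - real j * \<phi>)) \<le> sin (pi - (\<theta> - real (Suc j) * \<phi>))"
        using that False assms(2) mono[of "Suc j" m] mono[of j "Suc j"] mono[of 0 j] pi_gt_zero
        by (intro sin_monotone_2pi_le) (auto simp del: of_nat_Suc)
      then show ?thesis by simp
    qed
    then have "(\<Sum>j<m. min (sin (\<theta> - real j * \<phi>)) (sin (\<theta> - real (Suc j) * \<phi>)))
        = (\<Sum>j<m. sin (\<theta> - real j * \<phi>))"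
      by simp
    \<comment> \<open>The minimum of two numbers is their sum minus their maximum, and a sine is at
      most 1.\<close>
    moreover have "min (sin (\<theta> - real m * \<phi>)) (sin (\<theta> - real (Suc m) * \<phi>))
        \<ge> sin (\<theta> - real m * \<phi>) + sin (\<theta> - real (Suc m) * \<phi>) - 1"
      using sin_le_one[of "\<theta> - real m * \<phi>"] sin_le_one[of "\<theta> - real (Suc m) * \<phi>"] by linarith
    ultimately show ?thesis by (simp add: lessThan_Suc_atMost[symmetric])
  qed
qed

text \<open>This is where omitting edges pays off. If \<theta> is at most \<open>pi / 2\<close>, the
  sines decrease and the minima sum to the terms from 1 to \<open>m\<close>. Otherwise the unimodal
  sum may lose 1; the term at index 0, which is \<open>sin \<theta>\<close>, and the omitted term at
  index \<open>k\<close>, which is \<open>- cos \<theta>\<close>, together make up for it.\<close>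

lemma sum_min_sin_ge_vertex:
  assumes "0 < k" "0 \<le> \<theta>" "\<theta> \<le> pi"
    and m: "real m * (pi / (2 * real k)) \<le> \<theta>" "\<theta> < real (Suc m) * (pi / (2 * real k))"
  shows "(\<Sum>j<m. min (sin (\<theta> - real j * (pi / (2 * real k)))) (sin (\<theta> - real (Suc j) * (pi / (2 * real k)))))
           \<ge> - Im (mangled_vertex k m * cis (- \<theta>))"
proof -
  define \<phi> where "\<phi> = pi / (2 * real k)"
  note m = m[folded \<phi>_def]
  have \<phi>: "0 < \<phi>" "real k * \<phi> = pi / 2" using assms(1) by (simp_all add: \<phi>_def)
  have mono: "real i * \<phi> \<le> real j * \<phi>" if "i \<le> j" for i j
    using that \<phi>(1) by (simp add: mult_right_mono)
  have nn: "0 \<le> sin (\<theta> - real j * \<phi>)" if "j \<le> m" for j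
    using mono[OF that] m assms(3) mono[of 0 j] by (intro sin_ge_zero) auto
  have "- Im (mangled_vertex k m * cis (- \<theta>))
      = (\<Sum>j = 1..m. if k dvd j then 0 else sin (\<theta> - real j * \<phi>))"
    unfolding mangled_vertex_eq_sum[OF assms(1)] sum_distrib_right Im_sum Im_mangled_edge_cis
      sum_negf[symmetric] \<phi>_def
    by (intro sum.cong refl) (auto simp: sin_minus[symmetric] simp del: sin_minus)
  also have "\<dots> \<le> (\<Sum>j<m. min (sin (\<theta> - real j * \<phi>)) (sin (\<theta> - real (Suc j) * \<phi>)))"
  proof (cases "\<theta> \<le> pi / 2")
    case True
    have "(\<Sum>j = 1..m. if k dvd j then 0 else sin (\<theta> - real j * \<phi>)) \<le> (\<Sum>j = 1..m. sin (\<theta> - real j * \<phi>))"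
      using nn by (intro sum_mono) auto
    also have "\<dots> = (\<Sum>j<m. sin (\<theta> - real (Suc j) * \<phi>))"
      by (simp add: sum.atLeast1_atMost_eq del: of_nat_Suc)
    also have "\<dots> = (\<Sum>j<m. min (sin (\<theta> - real j * \<phi>)) (sin (\<theta> - real (Suc j) * \<phi>)))"
    proof (intro sum.cong refl)
      fix j assume "j \<in> {..<m}"
      then have "sin (\<theta> - real (Suc j) * \<phi>) \<le> sin (\<theta> - real j * \<phi>)"
        using True m mono[of "Suc j" m] mono[of j "Suc j"] mono[of 0 j]
        by (intro sin_monotone_2pi_le) (auto simp del: of_nat_Suc)
      then show "sin (\<theta> - real (Suc j) * \<phi>) = min (sin (\<theta> - real j * \<phi>)) (sin (\<theta> - real (Suc j) * \<phi>))"
        by simp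
    qed
    finally show ?thesis .
  next
    case False
    have "k \<le> m"
    proof (rule ccontr)
      assume "\<not> k \<le> m"
      then show False using mono[of "Suc m" k] m \<phi> False by auto
    qed
    \<comment> \<open>On the second quadrant both summands are nonnegative, so the square, and hence
      the sum, is at least 1.\<close>
    have "(sin \<theta> + (- cos \<theta>))\<^sup>2 = 1 + 2 * (sin \<theta> * (- cos \<theta>))"
      using sin_cos_squared_add[of \<theta>] by (simp add: power2_eq_square algebra_simps)
    moreover have "0 \<le> sin \<theta>" "0 \<le> - cos \<theta>"
      using False assms(3) cos_ge_zero[of "pi - \<theta>"] by (auto intro!: sin_ge_zero assms)
    ultimately have "1 \<le> (sin \<theta> + (- cos \<theta>))\<^sup>2" "0 \<le> sin \<theta> + (- cos \<theta>)"
      using mult_nonneg_nonneg[of "sin \<theta>" "- cos \<theta>"] by linarith+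
    then have ge1: "1 \<le> sin \<theta> - cos \<theta>"
      using power2_le_imp_le[of 1 "sin \<theta> + (- cos \<theta>)"] by simp
    have gk: "sin (\<theta> - real k * \<phi>) = - cos \<theta>"
      unfolding \<phi>(2) by (simp add: sin_diff)
    \<comment> \<open>At the other multiples of \<open>k\<close> the value 0 is bounded by the sine,
      which is nonnegative.\<close>
    have "(\<Sum>j = 1..m. if k dvd j then 0 else sin (\<theta> - real j * \<phi>))
        \<le> (\<Sum>j \<in> {1..m} - {k}. sin (\<theta> - real j * \<phi>))"
      using assms(1) \<open>k \<le> m\<close> nn
      by (subst sum.remove[where x = k]) (auto intro!: sum_mono split: if_splits)
    also have "\<dots> = (\<Sum>j = 1..m. sin (\<theta> - real j * \<phi>)) + cos \<theta>"
      using assms(1) \<open>k \<le> m\<close> gk by (subst sum.remove[where x = k and A = "{1..m}"]) auto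
    also have "\<dots> \<le> (\<Sum>j\<le>m. sin (\<theta> - real j * \<phi>)) - 1"
      using ge1 sum.atMost_shift[of "\<lambda>j. sin (\<theta> - real j * \<phi>)" m]
        sum.atLeast1_atMost_eq[of "\<lambda>j. sin (\<theta> - real j * \<phi>)" m] by simp
    also have "\<dots> \<le> (\<Sum>j<m. min (sin (\<theta> - real j * \<phi>)) (sin (\<theta> - real (Suc j) * \<phi>)))"
      using sum_min_sin_ge[of \<phi> \<theta> m] \<phi> assms(3) m by simp
    finally show ?thesis .
  qed
  finally show ?thesis unfolding \<phi>_def .
qed

(* Writing v = a cis \<alpha> + b cis \<beta> with a, b >= 0 gives a + b >= norm v. *)
lemma cone_vector_height:
  assumes "\<alpha> < \<beta>" "\<beta> < \<alpha> + pi"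
    and "0 \<le> Im (v * cis (- \<alpha>))" "Im (v * cis (- \<beta>)) \<le> 0"
    and "0 \<le> \<tau>" "\<tau> \<le> norm v" and "0 \<le> sin (\<theta> - \<alpha>)" "0 \<le> sin (\<theta> - \<beta>)"
  shows "\<tau> * min (sin (\<theta> - \<alpha>)) (sin (\<theta> - \<beta>)) \<le> - Im (v * cis (- \<theta>))"
proof -
  define s p q where "s = sin (\<beta> - \<alpha>)"
    and "p = - Im (v * cis (- \<beta>))" and "q = Im (v * cis (- \<alpha>))"
  define a b where "a = p / s" and "b = q / s"
  have s: "0 < s" unfolding s_def using assms by (intro sin_gt_zero) auto
  have ab: "0 \<le> a" "0 \<le> b" using assms s by (simp_all add: a_def b_def p_def q_def)
  \<comment> \<open>Cramer's rule for the basis \<open>cis \<alpha>\<close>,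
    \<open>cis \<beta>\<close>, whose determinant is
    \<open>sin (\<beta> - \<alpha>)\<close>.\<close>
  have "of_real s * v = of_real p * cis \<alpha> + of_real q * cis \<beta>"
    unfolding s_def p_def q_def by (rule complex_eqI; simp add: sin_diff algebra_simps)
  then have v: "v = of_real a * cis \<alpha> + of_real b * cis \<beta>"
    using s unfolding a_def b_def by (simp add: field_simps)
  have "norm v \<le> a + b"
    unfolding v using ab norm_triangle_ineq[of "of_real a * cis \<alpha>" "of_real b * cis \<beta>"]
    by (simp add: norm_mult)
  then have "\<tau> * min (sin (\<theta> - \<alpha>)) (sin (\<theta> - \<beta>)) \<le> (a + b) * min (sin (\<theta> - \<alpha>)) (sin (\<theta> - \<beta>))"
    using assms by (intro mult_right_mono) auto
  also have "\<dots> \<le> a * sin (\<theta> - \<alpha>) + b * sin (\<theta> - \<beta>)"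
    using ab by (simp add: distrib_right) (intro add_mono mult_left_mono; simp)
  also have "\<dots> = - Im (v * cis (- \<theta>))"
    unfolding v by (simp add: sin_diff algebra_simps)
  finally show ?thesis .
qed

section \<open>Chains of support points compared with the vertices\<close>

text \<open>The two sign conditions put each step of the chain into the cone between consecutive
  tangent directions. So \<open>cone_vector_height\<close> bounds how far it descends, and the
  descents telescope.\<close>

lemma support_chain_height:
  fixes Y :: "nat \<Rightarrow> complex"
  assumes "0 < k" "0 \<le> \<tau>" "0 \<le> \<theta>" "\<theta> \<le> pi"
    and m: "real m * (pi / (2 * real k)) \<le> \<theta>" "\<theta> < real (Suc m) * (pi / (2 * real k))"
    and "Y 0 = 0"
    and "\<And>j. 0 \<le> Im ((Y (Suc j) - Y j) * cis (- (real j * (pi / (2 * real k)))))"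
    and "\<And>j. Im ((Y (Suc j) - Y j) * cis (- (real (Suc j) * (pi / (2 * real k))))) \<le> 0"
    and "\<And>j. \<tau> \<le> norm (Y (Suc j) - Y j)"
  shows "Im (Y m * cis (- \<theta>)) \<le> \<tau> * Im (mangled_vertex k m * cis (- \<theta>))"
proof -
  define \<phi> where "\<phi> = pi / (2 * real k)"
  note a = assms(5-10)[folded \<phi>_def]
  have \<phi>: "0 < \<phi>" "\<phi> \<le> pi / 2" using assms(1) by (simp_all add: \<phi>_def field_simps)
  have mono: "real i * \<phi> \<le> real j * \<phi>" if "i \<le> j" for i j
    using that \<phi>(1) by (simp add: mult_right_mono)
  have nn: "0 \<le> sin (\<theta> - real j * \<phi>)" if "j \<le> m" for j
    using mono[OF that] a assms(4) mono[of 0 j] by (intro sin_ge_zero) auto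
  have "\<tau> * (- Im (mangled_vertex k m * cis (- \<theta>)))
      \<le> \<tau> * (\<Sum>j<m. min (sin (\<theta> - real j * \<phi>)) (sin (\<theta> - real (Suc j) * \<phi>)))"
    unfolding \<phi>_def using assms by (intro mult_left_mono sum_min_sin_ge_vertex) auto
  also have "\<dots> \<le> (\<Sum>j<m. - Im ((Y (Suc j) - Y j) * cis (- \<theta>)))"
    unfolding sum_distrib_left
  proof (intro sum_mono)
    fix j assume "j \<in> {..<m}"
    then show "\<tau> * min (sin (\<theta> - real j * \<phi>)) (sin (\<theta> - real (Suc j) * \<phi>)) \<le> - Im ((Y (Suc j) - Y j) * cis (- \<theta>))"
      using assms(2) a nn[of j] nn[of "Suc j"] \<phi> pi_gt_zero
      by (intro cone_vector_height) (auto simp: algebra_simps)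
  qed
  also have "\<dots> = - Im ((\<Sum>j<m. Y (Suc j) - Y j) * cis (- \<theta>))"
    unfolding sum_distrib_right Im_sum sum_negf ..
  also have "\<dots> = - Im (Y m * cis (- \<theta>))"
    using a(3) by (simp add: sum_lessThan_telescope)
  finally show ?thesis by linarith
qed

text \<open>The hypothesis on \<open>Y\<close> says that the line of direction \<alpha> through
  \<open>Y \<alpha>\<close> has all other values of \<open>Y\<close> on or to the left of it. Going
  from \<open>Y \<theta>\<close> to the last chain point before \<theta>, then to vertex
  \<open>m\<close>, then to vertex \<open>n\<close>, the height never decreases.\<close>

lemma support_point_below_vertex_ccw:
  fixes Y :: "real \<Rightarrow> complex"
  assumes "0 < k" "0 \<le> \<tau>" "0 \<le> \<theta>" "\<theta> \<le> pi" "n \<le> 4 * k"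
    and "Y 0 = 0"
    and supp: "\<And>\<alpha> \<beta>. 0 \<le> Im ((Y \<beta> - Y \<alpha>) * cis (- \<alpha>))"
    and sep: "\<And>\<alpha>. \<tau> \<le> norm (Y (\<alpha> + pi / (2 * real k)) - Y \<alpha>)"
  shows "Im (Y \<theta> * cis (- \<theta>)) \<le> \<tau> * Im (mangled_vertex k n * cis (- \<theta>))"
proof -
  define \<phi> where "\<phi> = pi / (2 * real k)"
  have \<phi>: "0 < \<phi>" "real k * \<phi> = pi / 2" using assms(1) by (simp_all add: \<phi>_def)
  define m where "m = nat \<lfloor>\<theta> / \<phi>\<rfloor>"
  have "real m \<le> \<theta> / \<phi>" "\<theta> / \<phi> < real (Suc m)"
    using assms(3) \<phi>(1) by (simp_all add: m_def) linarith+
  then have m: "real m * \<phi> \<le> \<theta>" "\<theta> < real (Suc m) * \<phi>"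
    using \<phi>(1) by (simp_all add: field_simps)
  have "real (2 * k) * \<phi> = pi" using \<phi>(2) by simp
  then have "real m * \<phi> \<le> real (2 * k) * \<phi>" using m assms(4) by linarith
  then have "real m \<le> real (2 * k)"
    using \<phi>(1) mult_le_cancel_right_pos by blast
  then have mk: "m \<le> 4 * k" by linarith
  have "Im (Y \<theta> * cis (- \<theta>)) \<le> Im (Y (real m * \<phi>) * cis (- \<theta>))"
    using supp[of "real m * \<phi>" \<theta>] by (simp add: left_diff_distrib)
  also have "\<dots> \<le> \<tau> * Im (mangled_vertex k m * cis (- \<theta>))"
  proof (rule support_chain_height[of k \<tau> \<theta> m "\<lambda>j. Y (real j * \<phi>)", folded \<phi>_def])
    fix j
    show "Im ((Y (real (Suc j) * \<phi>) - Y (real j * \<phi>)) * cis (- (real (Suc j) * \<phi>))) \<le> 0"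
      using supp[of "real j * \<phi>" "real (Suc j) * \<phi>"] by (simp add: left_diff_distrib)
    show "\<tau> \<le> norm (Y (real (Suc j) * \<phi>) - Y (real j * \<phi>))"
      using sep[of "real j * \<phi>"] by (simp add: \<phi>_def[symmetric] distrib_right add.commute)
  qed (use assms m supp in auto)
  also have "\<dots> \<le> \<tau> * Im (mangled_vertex k n * cis (- \<theta>))"
    using assms mk m unfolding \<phi>_def by (intro mult_left_mono mangled_vertex_minimal) auto
  finally show ?thesis .
qed

lemma support_point_below_vertex:
  fixes Y :: "real \<Rightarrow> complex"
  assumes "0 < k" "0 \<le> \<tau>" "\<bar>\<theta>\<bar> \<le> pi" "n < 4 * k"
    and "Y 0 = 0"
    and supp: "\<And>\<alpha> \<beta>. 0 \<le> Im ((Y \<beta> - Y \<alpha>) * cis (- \<alpha>))"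
    and sep: "\<And>\<alpha>. \<tau> \<le> norm (Y (\<alpha> + pi / (2 * real k)) - Y \<alpha>)"
  shows "Im (Y \<theta> * cis (- \<theta>)) \<le> \<tau> * Im (mangled_vertex k n * cis (- \<theta>))"
proof (cases "0 \<le> \<theta>")
  case True
  then show ?thesis using assms by (intro support_point_below_vertex_ccw) auto
next
  case False
  \<comment> \<open>Reflection in the imaginary axis reverses tangent angles and keeps the support
    property, so the counterclockwise case applies at \<open>- \<theta>\<close>.\<close>
  define Y' where "Y' = (\<lambda>\<alpha>. - cnj (Y (- \<alpha>)))"
  have "Im (Y' (- \<theta>) * cis (- (- \<theta>))) \<le> \<tau> * Im (mangled_vertex k (4 * k - 1 - n) * cis (- (- \<theta>)))"
  proof (rule support_point_below_vertex_ccw)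
    fix \<alpha> \<beta> :: real
    show "0 \<le> Im ((Y' \<beta> - Y' \<alpha>) * cis (- \<alpha>))"
      using supp[of "- \<beta>" "- \<alpha>"] by (simp add: Y'_def algebra_simps)
    \<comment> \<open>The reversal exchanges the two points of a pair, so separation is needed at
      the shifted angle \<open>- (\<alpha> + pi / (2 * real k))\<close>.\<close>
    have "norm (Y' (\<alpha> + pi / (2 * real k)) - Y' \<alpha>)
        = norm (cnj (Y (- (\<alpha> + pi / (2 * real k)) + pi / (2 * real k)) - Y (- (\<alpha> + pi / (2 * real k)))))"
      by (simp add: Y'_def del: complex_mod_cnj)
    then show "\<tau> \<le> norm (Y' (\<alpha> + pi / (2 * real k)) - Y' \<alpha>)"
      using sep[of "- (\<alpha> + pi / (2 * real k))"] by (simp only: complex_mod_cnj)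
  qed (use assms False in \<open>auto simp: Y'_def\<close>)
  then show ?thesis
    using mangled_vertex_reflect[OF assms(1,4)] by (simp add: Y'_def algebra_simps)
qed

section \<open>Normals of a convex body near a planar section\<close>

text \<open>A closed set need not be compact here. Instead the parallelogram law, with the midpoint
  in \<open>C\<close> by convexity, makes a minimizing sequence Cauchy, and completeness gives the
  limit.\<close>

lemma nearest_point_exists:
  fixes C :: "'a::{real_inner,complete_space} set"
  assumes "closed C" "convex C" "C \<noteq> {}"
  obtains q where "q \<in> C" "\<And>p. p \<in> C \<Longrightarrow> dist z q \<le> dist z p"
proof -
  define d where "d = infdist z C"
  have d0: "0 \<le> d" by (simp add: d_def infdist_nonneg)
  have dle: "d \<le> dist z p" if "p \<in> C" for p
    using that by (simp add: d_def infdist_le)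
  have "\<exists>p\<in>C. (dist z p)\<^sup>2 < d\<^sup>2 + e" if "0 < e" for e
  proof -
    have "infdist z C < sqrt (d\<^sup>2 + e)"
      using that d0 unfolding d_def[symmetric] by (intro real_less_rsqrt) simp
    then obtain p where "p \<in> C" "dist z p < sqrt (d\<^sup>2 + e)"
      using assms(3) by (metis cINF_less_iff bdd_below_image_dist infdist_notempty)
    moreover have "(sqrt (d\<^sup>2 + e))\<^sup>2 = d\<^sup>2 + e" using that by simp
    ultimately show ?thesis
      by (metis power_strict_mono zero_le_dist zero_less_numeral)
  qed
  then have "\<forall>n. \<exists>p\<in>C. (dist z p)\<^sup>2 < d\<^sup>2 + inverse (real (Suc n))" by simp
  then obtain p where p: "\<And>n. p n \<in> C" "\<And>n. (dist z (p n))\<^sup>2 < d\<^sup>2 + inverse (real (Suc n))"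
    by metis
  have gap: "(dist (p m) (p n))\<^sup>2 \<le> 2 * inverse (real (Suc m)) + 2 * inverse (real (Suc n))" for m n
  proof -
    have "(1/2) *\<^sub>R p m + (1/2) *\<^sub>R p n \<in> C"
      using assms(2) p(1) by (intro convexD) auto
    then have "d\<^sup>2 \<le> (norm (z - ((1/2) *\<^sub>R p m + (1/2) *\<^sub>R p n)))\<^sup>2"
      using dle d0 by (intro power_mono) (auto simp: dist_norm)
    moreover have "(norm (p m - p n))\<^sup>2 = 2 * (norm (z - p m))\<^sup>2 + 2 * (norm (z - p n))\<^sup>2
        - 4 * (norm (z - ((1/2) *\<^sub>R p m + (1/2) *\<^sub>R p n)))\<^sup>2"
      by (simp add: power2_norm_eq_inner inner_simps inner_commute algebra_simps)
    ultimately show ?thesis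
      using p(2)[of m] p(2)[of n] by (simp add: dist_norm)
  qed
  have "Cauchy p"
  proof (rule metric_CauchyI)
    fix e :: real assume "0 < e"
    then obtain N where N: "inverse (real (Suc N)) < e\<^sup>2 / 4"
      using reals_Archimedean[of "e\<^sup>2 / 4"] by auto
    have "dist (p m) (p n) < e" if "N \<le> m" "N \<le> n" for m n
    proof -
      have "inverse (real (Suc m)) \<le> inverse (real (Suc N))" "inverse (real (Suc n)) \<le> inverse (real (Suc N))"
        using that by (auto intro!: le_imp_inverse_le)
      then have "(dist (p m) (p n))\<^sup>2 < e\<^sup>2" using gap[of m n] N by linarith
      then show ?thesis by (rule power2_less_imp_less) (use \<open>0 < e\<close> in simp)
    qed
    then show "\<exists>N. \<forall>m\<ge>N. \<forall>n\<ge>N. dist (p m) (p n) < e" by blast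
  qed
  then obtain q where q: "p \<longlonglongrightarrow> q" using Cauchy_convergent convergentD by blast
  have "q \<in> C" using assms(1) p(1) q closed_sequentially by blast
  have "(\<lambda>n. d\<^sup>2 + inverse (real (Suc n))) \<longlonglongrightarrow> d\<^sup>2 + 0"
    by (intro tendsto_intros LIMSEQ_inverse_real_of_nat)
  moreover have "(\<lambda>n. (dist z (p n))\<^sup>2) \<longlonglongrightarrow> (dist z q)\<^sup>2"
    by (intro tendsto_intros q)
  ultimately have "(dist z q)\<^sup>2 \<le> d\<^sup>2 + 0"
    using p(2) by (intro LIMSEQ_le) (auto intro: less_imp_le)
  then have "dist z q \<le> d" using d0 power2_le_imp_le[of "dist z q" d] by simp
  then show ?thesis using that \<open>q \<in> C\<close> dle by force
qed

section \<open>Normals orthogonal to a prescribed direction\<close>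

lemma outer_normals_imp_frontier:
  fixes K :: "'a::real_inner set"
  assumes "k \<in> K" "u \<in> outer_normals K k"
  shows "k \<in> frontier K"
proof -
  have u: "norm u = 1" "\<And>y. y \<in> K \<Longrightarrow> (y - k) \<bullet> u \<le> 0"
    using assms(2) by (auto simp: outer_normals_def)
  have "k \<notin> interior K"
  proof
    assume "k \<in> interior K"
    then obtain e where e: "0 < e" "cball k e \<subseteq> K" by (meson mem_interior_cball)
    then have "k + e *\<^sub>R u \<in> K" using u(1) by (auto simp: dist_norm)
    then have "e * (u \<bullet> u) \<le> 0" using u(2) by force
    then show False using u(1) e by (simp add: dot_square_norm)
  qed
  then show ?thesis using assms(1) closure_subset by (auto simp: frontier_def)
qed

(* Projecting onto the sum of K and a long segment in direction e makes the normal orthogonal to e. *)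
lemma normal_orthogonal_to_line:
  fixes K :: "'a::{real_inner,complete_space} set"
  assumes "closed K" "convex K" "bounded K" "y \<in> K" "norm e = 1"
    and line: "\<And>s. z + s *\<^sub>R e \<notin> K"
  obtains k u s where "k \<in> K" "u \<in> outer_normals K k" "u \<bullet> e = 0" "norm (z + s *\<^sub>R e - k) \<le> dist z y"
proof -
  obtain D where D: "\<And>p. p \<in> K \<Longrightarrow> dist y p \<le> D"
    using assms(3) by (meson bounded_any_center)
  \<comment> \<open>The half-length exceeds every shift that the nearest point can involve, so that
    shift is interior to the segment.\<close>
  define S where "S = D + 2 * dist z y + 1"
  define T where "T = (\<lambda>s. s *\<^sub>R e) ` {-S..S}"
  define C where "C = (\<Union>p\<in>K. \<Union>t\<in>T. {p + t})"
  have S: "0 < S" using D[OF assms(4)] by (simp add: S_def add_nonneg_pos)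
  have T: "compact T" "convex T"
    unfolding T_def by (auto intro!: compact_continuous_image continuous_intros convex_linear_image linear_scaleR_left)
  have C: "closed C" "convex C"
    unfolding C_def using closed_compact_sums[OF assms(1) T(1)] convex_sums[OF assms(2) T(2)] by auto
  have inC: "p + s *\<^sub>R e \<in> C" if "p \<in> K" "\<bar>s\<bar> \<le> S" for p s
    using that unfolding C_def T_def by (auto simp: abs_le_iff intro!: bexI[of _ p] bexI[of _ s])
  have "y \<in> C" using inC[OF assms(4), of 0] S by simp
  then obtain q where q: "q \<in> C" "\<And>p. p \<in> C \<Longrightarrow> dist z q \<le> dist z p"
    using nearest_point_exists[OF C] by blast
  then obtain k s where "k \<in> K" "s \<in> {-S..S}" "q = k + s *\<^sub>R e"
    unfolding C_def T_def by blast
  then have ks: "k \<in> K" "\<bar>s\<bar> \<le> S" "q = k + s *\<^sub>R e" by auto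
  have qy: "dist z q \<le> dist z y" using q(2) \<open>y \<in> C\<close> .
  have "q \<noteq> z" using line[of "- s"] ks by auto
  have dot: "(z - q) \<bullet> (p - q) \<le> 0" if "p \<in> C" for p
    using any_closest_point_dot[OF C(2) C(1) q(1) that] q(2) by blast
  have "\<bar>s\<bar> = norm ((q - z) + (z - y) + (y - k))" using ks assms(5) by simp
  also have "\<dots> \<le> norm (q - z) + norm (z - y) + norm (y - k)"
    by (intro order.trans[OF norm_triangle_ineq] add_right_mono norm_triangle_ineq)
  also have "\<dots> < S" using qy D[OF ks(1)] by (simp add: S_def dist_norm norm_minus_commute)
  finally have "\<bar>s\<bar> < S" .
  \<comment> \<open>Both signs of \<open>t\<close> are admissible near an interior shift, which
    forces \<open>z - q\<close> to be orthogonal to \<open>e\<close>.\<close>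
  have "t * ((z - q) \<bullet> e) \<le> 0" if "\<bar>s + t\<bar> \<le> S" for t
    using dot[OF inC[OF ks(1) that]] by (simp add: ks(3) algebra_simps inner_simps)
  from this[of "S - \<bar>s\<bar>"] this[of "- (S - \<bar>s\<bar>)"]
  have "(S - \<bar>s\<bar>) * ((z - q) \<bullet> e) = 0"
    using ks(2) by (simp only: mult_minus_left) linarith
  then have ze: "(z - q) \<bullet> e = 0" using \<open>\<bar>s\<bar> < S\<close> by simp
  define u where "u = (z - q) /\<^sub>R norm (z - q)"
  have "(p - k) \<bullet> u \<le> 0" if "p \<in> K" for p
  proof -
    have "(z - q) \<bullet> (p - k) \<le> 0"
      using dot[OF inC[OF that ks(2)]] by (simp add: ks(3))
    then show ?thesis
      by (simp add: u_def inner_commute mult_nonneg_nonpos divide_inverse_commute)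
  qed
  then have "u \<in> outer_normals K k"
    using \<open>q \<noteq> z\<close> by (simp add: outer_normals_def u_def)
  moreover have "u \<bullet> e = 0" using ze by (simp add: u_def)
  moreover have "norm (z + (- s) *\<^sub>R e - k) \<le> dist z y"
    using qy by (simp add: ks(3) dist_norm algebra_simps)
  ultimately show ?thesis using that ks(1) by blast
qed

text \<open>Unit normals along a convergent sequence of boundary points need not converge in norm in
  infinite dimension, so approximating normals are recorded instead of one at \<open>y\<close>. The
  bound \<rho> keeps their projections away from 0.\<close>

definition limit_normal :: "'a::real_inner set \<Rightarrow> real \<Rightarrow> 'a \<Rightarrow> 'a \<Rightarrow> 'a \<Rightarrow> bool" where
  "limit_normal K \<rho> y e w \<longleftrightarrow>
     (\<forall>\<delta>>0. \<exists>k\<in>frontier K. \<exists>u\<in>outer_normals K k. dist k y < \<delta> \<and> u \<bullet> e = 0 \<and> \<rho> < u \<bullet> w)"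

lemma inner_outer_normal_ge:
  assumes "cball c r \<subseteq> K" "0 \<le> r" "u \<in> outer_normals K k"
  shows "r \<le> (k - c) \<bullet> u"
proof -
  have u: "norm u = 1" "\<And>y. y \<in> K \<Longrightarrow> (y - k) \<bullet> u \<le> 0"
    using assms(3) by (auto simp: outer_normals_def)
  have "c + r *\<^sub>R u \<in> K" using assms u(1) by (auto simp: dist_norm)
  then have "(c + r *\<^sub>R u - k) \<bullet> u \<le> 0" by (rule u(2))
  moreover have "u \<bullet> u = 1" using u(1) by (simp add: dot_square_norm)
  ultimately show ?thesis by (simp add: inner_simps)
qed

text \<open>Lines parallel to the supporting line and slightly above it miss \<open>K\<close>, hence
  give normals orthogonal to \<open>e\<close> at points of \<open>K\<close> close to these lines.
  Their positions along \<open>e\<close> are bounded, so a subsequence of the points converges to a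
  point of \<open>K\<close> on the supporting line.\<close>

lemma support_point_with_limit_normal:
  fixes K :: "'a::{real_inner,complete_space} set"
  assumes "closed K" "convex K" "cball c r \<subseteq> K" "K \<subseteq> cball c R" "0 < r" "0 < R"
    and e: "norm e = 1" "norm w = 1" "e \<bullet> w = 0"
  obtains a b where "c + a *\<^sub>R e + b *\<^sub>R w \<in> K"
    and "\<And>a' b'. c + a' *\<^sub>R e + b' *\<^sub>R w \<in> K \<Longrightarrow> b' \<le> b"
    and "limit_normal K (r / (2 * R)) (c + a *\<^sub>R e + b *\<^sub>R w) e w"
proof -
  have ee: "e \<bullet> e = 1" "w \<bullet> w = 1" "w \<bullet> e = 0"
    using e by (simp_all add: dot_square_norm inner_commute)
  \<comment> \<open>An isometric parametrisation of the plane by pairs of reals: the slice is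
    compact even if \<open>K\<close> is not.\<close>
  define G where "G = (\<lambda>v::real \<times> real. c + fst v *\<^sub>R e + snd v *\<^sub>R w)"
  have contG: "continuous_on UNIV G" unfolding G_def by (intro continuous_intros)
  have normG: "norm (G v - c) = norm v" for v
  proof -
    have "G v - c = fst v *\<^sub>R e + snd v *\<^sub>R w" by (simp add: G_def)
    then have "(norm (G v - c))\<^sup>2 = (fst v)\<^sup>2 + (snd v)\<^sup>2"
      unfolding power2_norm_eq_inner by (simp add: inner_simps ee e power2_eq_square)
    then show ?thesis by (metis norm_ge_zero norm_prod_def real_norm_def power2_abs real_sqrt_unique)
  qed
  have cK: "c \<in> K" using assms by auto
  have compactL: "compact (G -` K)"
  proof -
    have "closed (G -` K)" using assms(1) contG by (rule closed_vimage)
    moreover have "norm v \<le> R" if "v \<in> G -` K" for v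
    proof -
      have "G v \<in> cball c R" using that assms(4) by auto
      then show ?thesis using normG[of v] by (simp add: dist_norm norm_minus_commute)
    qed
    then have "bounded (G -` K)" by (intro boundedI)
    ultimately show ?thesis by (simp add: compact_eq_bounded_closed)
  qed
  have "G 0 = c" by (simp add: G_def)
  then have "G -` K \<noteq> {}" using cK by auto
  moreover have "continuous_on (G -` K) snd" by (intro continuous_intros)
  ultimately obtain v0 where "v0 \<in> G -` K" "\<forall>v\<in>G -` K. snd v \<le> snd v0"
    using continuous_attains_sup[OF compactL] by blast
  then have v0: "G v0 \<in> K" "\<And>v. G v \<in> K \<Longrightarrow> snd v \<le> snd v0" by auto
  define a0 b where "a0 = fst v0" and "b = snd v0"
  have max: "b' \<le> b" if "c + a' *\<^sub>R e + b' *\<^sub>R w \<in> K" for a' b'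
    using v0(2)[of "(a', b')"] that by (simp add: G_def b_def)
  have y0: "c + a0 *\<^sub>R e + b *\<^sub>R w \<in> K" using v0(1) by (simp add: G_def a0_def b_def)
  have bR: "b \<le> R"
  proof -
    have "\<bar>b\<bar> \<le> norm v0" unfolding b_def using norm_snd_le[of "snd v0" "fst v0"] by simp
    also have "\<dots> \<le> R" using normG[of v0] v0(1) assms(4) by (auto simp: dist_norm norm_minus_commute)
    finally show ?thesis by simp
  qed
  define z where "z n = c + a0 *\<^sub>R e + (b + inverse (real (Suc n))) *\<^sub>R w" for n
  have "\<exists>k u s. k \<in> K \<and> u \<in> outer_normals K k \<and> u \<bullet> e = 0 \<and> norm (z n + s *\<^sub>R e - k) \<le> inverse (real (Suc n))" for n
  proof -
    have "z n + s *\<^sub>R e \<notin> K" for s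
    proof
      assume "z n + s *\<^sub>R e \<in> K"
      then have "c + (a0 + s) *\<^sub>R e + (b + inverse (real (Suc n))) *\<^sub>R w \<in> K"
        by (simp add: z_def algebra_simps)
      then show False using max by fastforce
    qed
    moreover have "dist (z n) (c + a0 *\<^sub>R e + b *\<^sub>R w) = inverse (real (Suc n))"
      using e by (simp add: z_def dist_norm algebra_simps)
    moreover have "bounded K" using assms(4) bounded_cball bounded_subset by blast
    ultimately show ?thesis
      using normal_orthogonal_to_line[OF assms(1,2) _ y0 e(1), of "z n"] by metis
  qed
  then obtain k u s where kus: "\<And>n. k n \<in> K" "\<And>n. u n \<in> outer_normals K (k n)" "\<And>n. u n \<bullet> e = 0"
      "\<And>n. norm (z n + s n *\<^sub>R e - k n) \<le> inverse (real (Suc n))"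
    by metis
  have sbound: "\<bar>s n\<bar> \<le> R + 1 + \<bar>a0\<bar>" for n
  proof -
    have "a0 + s n = (z n + s n *\<^sub>R e - k n) \<bullet> e + (k n - c) \<bullet> e"
      by (simp add: z_def inner_simps ee)
    also have "\<bar>\<dots>\<bar> \<le> norm (z n + s n *\<^sub>R e - k n) + norm (k n - c)"
      using Cauchy_Schwarz_ineq2[of "z n + s n *\<^sub>R e - k n" e] Cauchy_Schwarz_ineq2[of "k n - c" e] e(1)
      by (simp del: inner_diff_left inner_add_left)
    also have "\<dots> \<le> 1 + R"
    proof (rule add_mono)
      show "norm (z n + s n *\<^sub>R e - k n) \<le> 1"
        by (rule order.trans[OF kus(4)]) (simp add: inverse_le_1_iff)
      show "norm (k n - c) \<le> R" using kus(1)[of n] assms(4) by (auto simp: dist_norm norm_minus_commute)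
    qed
    finally show ?thesis by linarith
  qed
  have "compact {- (R + 1 + \<bar>a0\<bar>)..R + 1 + \<bar>a0\<bar>}" by simp
  moreover have "\<forall>n. s n \<in> {- (R + 1 + \<bar>a0\<bar>)..R + 1 + \<bar>a0\<bar>}" using sbound by (auto simp only: atLeastAtMost_iff abs_le_iff minus_le_iff)
  ultimately obtain t \<sigma> where \<sigma>: "strict_mono (\<sigma>::nat \<Rightarrow> nat)" "(s \<circ> \<sigma>) \<longlonglongrightarrow> t"
    unfolding compact_def by meson
  \<comment> \<open>The limit may differ from the maximizer first chosen, but it has the same height
    \<open>b\<close> and so is a maximizer too.\<close>
  define y where "y = c + (a0 + t) *\<^sub>R e + b *\<^sub>R w"
  have inv0: "(\<lambda>n. inverse (real (Suc (\<sigma> n)))) \<longlonglongrightarrow> 0"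
    using LIMSEQ_subseq_LIMSEQ[OF LIMSEQ_inverse_real_of_nat \<sigma>(1)] by (simp add: o_def)
  have "(\<lambda>n. z (\<sigma> n) + s (\<sigma> n) *\<^sub>R e) \<longlonglongrightarrow> c + a0 *\<^sub>R e + (b + 0) *\<^sub>R w + t *\<^sub>R e"
    unfolding z_def using \<sigma>(2) by (intro tendsto_intros inv0) (simp add: o_def)
  moreover have "(\<lambda>n. z (\<sigma> n) + s (\<sigma> n) *\<^sub>R e - k (\<sigma> n)) \<longlonglongrightarrow> 0"
    using kus(4) by (intro Lim_null_comparison[OF _ inv0]) auto
  ultimately have "(\<lambda>n. (z (\<sigma> n) + s (\<sigma> n) *\<^sub>R e) - (z (\<sigma> n) + s (\<sigma> n) *\<^sub>R e - k (\<sigma> n)))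
      \<longlonglongrightarrow> (c + a0 *\<^sub>R e + (b + 0) *\<^sub>R w + t *\<^sub>R e) - 0"
    by (rule tendsto_diff)
  then have ky: "(\<lambda>n. k (\<sigma> n)) \<longlonglongrightarrow> y" by (simp add: y_def algebra_simps)
  have "y \<in> K" using closed_sequentially[OF assms(1) _ ky] kus(1) by blast
  moreover have "limit_normal K (r / (2 * R)) y e w"
    unfolding limit_normal_def
  proof (intro allI impI)
    fix \<delta> :: real assume "0 < \<delta>"
    \<comment> \<open>Within \<open>r / 2\<close> of \<open>y\<close> at least half of the support
      value \<open>r\<close> remains for \<open>(y - c) \<bullet> u'\<close>, which equals
      \<open>b * (u' \<bullet> w)\<close> with \<open>b\<close> at most \<open>R\<close>.\<close>
    then have "0 < min \<delta> (r / 2)" using assms(5) by simp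
    then obtain n where n: "dist (k (\<sigma> n)) y < min \<delta> (r / 2)"
      using ky by (meson lim_sequentially order_refl)
    define k' u' where "k' = k (\<sigma> n)" and "u' = u (\<sigma> n)"
    have u': "u' \<in> outer_normals K k'" "u' \<bullet> e = 0" "k' \<in> K" "norm u' = 1"
      using kus[of "\<sigma> n"] by (auto simp: k'_def u'_def outer_normals_def)
    have "(y - c) \<bullet> u' = b * (u' \<bullet> w)"
      using u'(2) by (simp add: y_def inner_simps inner_commute)
    moreover have "(k' - y) \<bullet> u' \<le> dist k' y"
      using Cauchy_Schwarz_ineq2[of "k' - y" u'] u'(4) by (simp add: dist_norm)
    moreover have "r \<le> (k' - y) \<bullet> u' + (y - c) \<bullet> u'"
      using inner_outer_normal_ge[OF assms(3) _ u'(1)] assms(5) by (simp add: inner_simps)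
    ultimately have 1: "r / 2 < b * (u' \<bullet> w)" using n by (simp add: k'_def)
    have "0 \<le> b" using max[of 0 0] cK by simp
    then have "0 < u' \<bullet> w" using 1 assms(5) by (meson half_gt_zero less_trans mult_nonneg_nonpos not_less)
    then have "b * (u' \<bullet> w) \<le> R * (u' \<bullet> w)" using bR by simp
    then have "r / (2 * R) < u' \<bullet> w" using 1 assms(6) by (simp add: field_simps)
    then show "\<exists>k\<in>frontier K. \<exists>u\<in>outer_normals K k. dist k y < \<delta> \<and> u \<bullet> e = 0 \<and> r / (2 * R) < u \<bullet> w"
      using u' n outer_normals_imp_frontier by (auto simp: k'_def)
  qed
  ultimately show ?thesis using that max unfolding y_def by blast
qed

text \<open>The chord of an angle \<phi> on the unit circle has length
  \<open>2 * sin (\<phi> / 2)\<close>. All angles are at most \<open>pi\<close>, so the supremum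
  really is an upper bound.\<close>

lemma outer_normal_dist_le:
  assumes "normal_modulus K \<tau> \<le> \<phi>" "0 \<le> \<phi>" "\<phi> \<le> pi"
    and "x \<in> frontier K" "y \<in> frontier K" "dist x y \<le> \<tau>" "u \<in> outer_normals K x" "w \<in> outer_normals K y"
  shows "norm (u - w) \<le> 2 * sin (\<phi> / 2)"
proof -
  have n: "norm u = 1" "norm w = 1" using assms by (auto simp: outer_normals_def)
  then have uw: "\<bar>u \<bullet> w\<bar> \<le> 1" using Cauchy_Schwarz_ineq2[of u w] by simp
  let ?A = "{arccos (u \<bullet> w) | u w x y.
            x \<in> frontier K \<and> y \<in> frontier K \<and> dist x y \<le> \<tau> \<and>
            u \<in> outer_normals K x \<and> w \<in> outer_normals K y}"
  have "bdd_above ?A"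
  proof (rule bdd_aboveI[of _ pi])
    fix t assume "t \<in> ?A"
    then obtain u w x y where t: "t = arccos (u \<bullet> w)" "u \<in> outer_normals K x" "w \<in> outer_normals K y" by auto
    then have "\<bar>u \<bullet> w\<bar> \<le> 1" using Cauchy_Schwarz_ineq2[of u w] by (simp add: outer_normals_def)
    then show "t \<le> pi" using t arccos_ubound by (simp add: abs_le_iff)
  qed
  moreover have "arccos (u \<bullet> w) \<in> ?A" using assms by blast
  ultimately have "arccos (u \<bullet> w) \<le> normal_modulus K \<tau>"
    unfolding normal_modulus_def by (intro cSup_upper)
  then have "arccos (u \<bullet> w) \<le> \<phi>" using assms(1) by linarith
  then have "cos \<phi> \<le> cos (arccos (u \<bullet> w))"
    using uw assms by (intro cos_monotone_0_pi_le) (auto intro: arccos_lbound)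
  then have "cos \<phi> \<le> u \<bullet> w" using uw by (simp add: cos_arccos_abs)
  moreover have "cos \<phi> = 1 - 2 * (sin (\<phi> / 2))\<^sup>2" using cos_double_sin[of "\<phi> / 2"] by simp
  moreover have "(norm (u - w))\<^sup>2 = 2 - 2 * (u \<bullet> w)"
    using n dot_norm_neg[of u w] by simp
  ultimately have "(norm (u - w))\<^sup>2 \<le> (2 * sin (\<phi> / 2))\<^sup>2" by (simp add: power_mult_distrib)
  moreover have "0 \<le> sin (\<phi> / 2)" using assms by (intro sin_ge_zero) auto
  ultimately show ?thesis by (intro power2_le_imp_le[of "norm (u - w)" "2 * sin (\<phi> / 2)"]) auto
qed

section \<open>Distance between support points with different tangent directions\<close>

lemma bessel_two:
  fixes f1 f2 v :: "'a::real_inner"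
  assumes "norm f1 = 1" "norm f2 = 1" "f1 \<bullet> f2 = 0"
  shows "(v \<bullet> f1)\<^sup>2 + (v \<bullet> f2)\<^sup>2 \<le> (norm v)\<^sup>2"
proof -
  have "f1 \<bullet> f1 = 1" "f2 \<bullet> f2 = 1" using assms by (simp_all add: dot_square_norm)
  moreover have "0 \<le> (v - (v \<bullet> f1) *\<^sub>R f1 - (v \<bullet> f2) *\<^sub>R f2) \<bullet> (v - (v \<bullet> f1) *\<^sub>R f1 - (v \<bullet> f2) *\<^sub>R f2)"
    by (rule inner_ge_zero)
  ultimately show ?thesis
    using assms(3) inner_commute[of f1 v] inner_commute[of f2 v] inner_commute[of f2 f1]
    by (simp only: power2_norm_eq_inner) (simp add: inner_diff_left inner_diff_right power2_eq_square algebra_simps)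
qed

text \<open>If the points were closer than \<tau>, normals at nearby boundary points would differ by
  at most \<open>2 * sin (\<phi> / 2)\<close>. Their projections, longer than \<rho> and at angle
  \<open>\<theta> - \<theta>'\<close>, differ by more than that.\<close>

lemma dist_limit_normals_ge:
  fixes K :: "'a::real_inner set"
  assumes mod: "normal_modulus K \<tau> \<le> \<phi>" "0 < \<phi>" "\<phi> \<le> pi" and "0 < \<rho>"
    and f: "norm f1 = 1" "norm f2 = 1" "f1 \<bullet> f2 = 0"
    and lim: "limit_normal K \<rho> y (cos \<theta> *\<^sub>R f1 + sin \<theta> *\<^sub>R f2) (sin \<theta> *\<^sub>R f1 - cos \<theta> *\<^sub>R f2)"
      "limit_normal K \<rho> y' (cos \<theta>' *\<^sub>R f1 + sin \<theta>' *\<^sub>R f2) (sin \<theta>' *\<^sub>R f1 - cos \<theta>' *\<^sub>R f2)"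
    and angle: "sin (\<phi> / 2) \<le> \<rho> * \<bar>sin ((\<theta> - \<theta>') / 2)\<bar>"
  shows "\<tau> \<le> dist y y'"
proof (rule ccontr)
  assume "\<not> \<tau> \<le> dist y y'"
  then have "0 < (\<tau> - dist y y') / 2" by simp
  note ex = lim[unfolded limit_normal_def, rule_format, OF this]
  from ex(1) obtain k u where k: "k \<in> frontier K" "u \<in> outer_normals K k" "dist k y < (\<tau> - dist y y') / 2"
      "u \<bullet> (cos \<theta> *\<^sub>R f1 + sin \<theta> *\<^sub>R f2) = 0" "\<rho> < u \<bullet> (sin \<theta> *\<^sub>R f1 - cos \<theta> *\<^sub>R f2)"
    by blast
  from ex(2) obtain k' u' where k': "k' \<in> frontier K" "u' \<in> outer_normals K k'" "dist k' y' < (\<tau> - dist y y') / 2"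
      "u' \<bullet> (cos \<theta>' *\<^sub>R f1 + sin \<theta>' *\<^sub>R f2) = 0" "\<rho> < u' \<bullet> (sin \<theta>' *\<^sub>R f1 - cos \<theta>' *\<^sub>R f2)"
    by blast
  \<comment> \<open>A plane vector orthogonal to \<open>(cos t, sin t)\<close> is a multiple of
    \<open>(sin t, - cos t)\<close>.\<close>
  have polar: "p = l * sin t" "q = - (l * cos t)"
    if "p * cos t + q * sin t = 0" "l = p * sin t - q * cos t" for p q l t :: real
  proof -
    have "l * sin t + (p * cos t + q * sin t) * cos t = p * ((sin t)\<^sup>2 + (cos t)\<^sup>2)"
      "- (l * cos t) + (p * cos t + q * sin t) * sin t = q * ((sin t)\<^sup>2 + (cos t)\<^sup>2)"
      unfolding that(2) by algebra+
    then show "p = l * sin t" "q = - (l * cos t)" using that(1) by simp_all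
  qed
  define l l' where "l = u \<bullet> (sin \<theta> *\<^sub>R f1 - cos \<theta> *\<^sub>R f2)" and "l' = u' \<bullet> (sin \<theta>' *\<^sub>R f1 - cos \<theta>' *\<^sub>R f2)"
  have uf: "u \<bullet> f1 = l * sin \<theta>" "u \<bullet> f2 = - (l * cos \<theta>)"
    using k(4) polar[of "u \<bullet> f1" \<theta> "u \<bullet> f2" l]
    by (simp_all add: l_def inner_simps mult.commute)
  have uf': "u' \<bullet> f1 = l' * sin \<theta>'" "u' \<bullet> f2 = - (l' * cos \<theta>')"
    using k'(4) polar[of "u' \<bullet> f1" \<theta>' "u' \<bullet> f2" l']
    by (simp_all add: l'_def inner_simps mult.commute)
  define S where "S = \<bar>sin ((\<theta> - \<theta>') / 2)\<bar>"
  have cosS: "cos (\<theta> - \<theta>') = 1 - 2 * S\<^sup>2"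
  proof -
    have "2 * ((\<theta> - \<theta>') / 2) = \<theta> - \<theta>'" by simp
    then show ?thesis
      using cos_double_sin[of "(\<theta> - \<theta>') / 2"] unfolding S_def power2_abs by presburger
  qed
  have sp: "0 < sin (\<phi> / 2)" using mod by (intro sin_gt_zero) auto
  have S: "0 < S"
  proof (rule ccontr)
    assume "\<not> 0 < S"
    then have "S = 0" by (simp add: S_def)
    then show False using angle sp by (simp add: S_def)
  qed
  have "dist k k' \<le> dist k y + dist y y' + dist k' y'"
    by (metis add.commute add_left_mono dist_commute dist_triangle dist_triangle_le)
  then have "dist k k' \<le> \<tau>" using k(3) k'(3) by argo
  then have "norm (u - u') \<le> 2 * sin (\<phi> / 2)"
    using mod k k' by (intro outer_normal_dist_le[of K \<tau> \<phi> k k']) auto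
  then have "(norm (u - u'))\<^sup>2 \<le> (2 * sin (\<phi> / 2))\<^sup>2" by (rule power_mono) simp
  then have "((u - u') \<bullet> f1)\<^sup>2 + ((u - u') \<bullet> f2)\<^sup>2 \<le> (2 * sin (\<phi> / 2))\<^sup>2"
    using bessel_two[OF f] order.trans by blast
  also have "\<dots> \<le> (2 * (\<rho> * S))\<^sup>2"
    using angle sp unfolding S_def by (intro power_mono) auto
  also have "\<dots> = 4 * (\<rho> * \<rho>) * S\<^sup>2" by (simp add: power2_eq_square)
  also have "\<dots> < 4 * (l * l') * S\<^sup>2"
    using k(5) k'(5) assms(4) S
    by (intro mult_strict_right_mono mult_strict_left_mono mult_strict_mono) (auto simp: l_def l'_def)
  \<comment> \<open>Law of cosines in half-angle form: the expression on the right is the squared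
    distance of the two projections.\<close>
  also have "\<dots> \<le> (l - l')\<^sup>2 + 4 * (l * l') * S\<^sup>2" by simp
  also have "\<dots> = l\<^sup>2 + l'\<^sup>2 - 2 * (l * l') * cos (\<theta> - \<theta>')"
    unfolding cosS by (simp add: power2_diff algebra_simps)
  also have "\<dots> = l\<^sup>2 * ((sin \<theta>)\<^sup>2 + (cos \<theta>)\<^sup>2) + l'\<^sup>2 * ((sin \<theta>')\<^sup>2 + (cos \<theta>')\<^sup>2)
      - 2 * (l * l') * cos (\<theta> - \<theta>')" by simp
  also have "\<dots> = ((u - u') \<bullet> f1)\<^sup>2 + ((u - u') \<bullet> f2)\<^sup>2"
    unfolding inner_diff_left uf uf' cos_diff by algebra
  finally show False by simp
qed

section \<open>The inscribed mangled polygon\<close>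

text \<open>A vertex outside the slice is separated from it by a line of some direction \<theta>.
  The support point for \<theta> would then be strictly higher than the vertex, against
  \<open>support_point_below_vertex\<close>.\<close>

lemma mangled_vertex_in_slice:
  fixes K :: "'a::{real_inner,complete_space} set"
  assumes K: "closed K" "convex K" "cball c r \<subseteq> K" "K \<subseteq> cball c R" "0 < r" "0 < R"
    and mod: "normal_modulus K \<tau> \<le> \<phi>" "0 < \<phi>" "\<phi> \<le> pi" and "0 \<le> \<tau>"
    and k: "0 < k" "sin (\<phi> / 2) \<le> r / (2 * R) * sin (pi / (4 * real k))"
    and f: "norm f1 = 1" "norm f2 = 1" "f1 \<bullet> f2 = 0"
    and c: "c = x + Re cz *\<^sub>R f1 + Im cz *\<^sub>R f2"
    and x: "x \<in> K" "\<And>z. x + Re z *\<^sub>R f1 + Im z *\<^sub>R f2 \<in> K \<Longrightarrow> 0 \<le> Im z"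
      "limit_normal K (r / (2 * R)) x f1 (- f2)"
    and "n < 4 * k" and v: "v = \<tau> *\<^sub>R mangled_vertex k n"
  shows "x + Re v *\<^sub>R f1 + Im v *\<^sub>R f2 \<in> K"
proof (rule ccontr)
  define F where "F = (\<lambda>z. x + Re z *\<^sub>R f1 + Im z *\<^sub>R f2)"
  assume "\<not> ?thesis"
  then have vL: "v \<notin> F -` K" by (simp add: F_def)
  have ff: "f1 \<bullet> f1 = 1" "f2 \<bullet> f2 = 1" "f2 \<bullet> f1 = 0" "f1 \<bullet> f2 = 0"
    using f by (simp_all add: dot_square_norm inner_commute)
  have distF: "dist (F z) (F z') = norm (z - z')" for z z'
  proof -
    have "F z - F z' = Re (z - z') *\<^sub>R f1 + Im (z - z') *\<^sub>R f2"
      by (simp add: F_def algebra_simps)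
    then have "(dist (F z) (F z'))\<^sup>2 = (Re (z - z'))\<^sup>2 + (Im (z - z'))\<^sup>2"
      unfolding dist_norm power2_norm_eq_inner by (simp add: inner_simps ff power2_eq_square)
    then show ?thesis unfolding cmod_def using real_sqrt_unique[of "dist (F z) (F z')"] by simp
  qed
  have closedL: "closed (F -` K)"
    using K(1) by (rule closed_vimage) (auto simp: F_def intro!: continuous_intros)
  have convexL: "convex (F -` K)"
  proof (rule convexI)
    fix z z' and s t :: real assume *: "z \<in> F -` K" "z' \<in> F -` K" "0 \<le> s" "0 \<le> t" "s + t = 1"
    have "F (s *\<^sub>R z + t *\<^sub>R z') = (1 - (s + t)) *\<^sub>R x + s *\<^sub>R F z + t *\<^sub>R F z'"
      by (simp add: F_def algebra_simps)
    then show "s *\<^sub>R z + t *\<^sub>R z' \<in> F -` K"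
      using * convexD[OF K(2), of "F z" "F z'" s t] by simp
  qed
  have F0: "F 0 = x" by (simp add: F_def)
  \<comment> \<open>At angle 0 the support point must be \<open>x\<close>, where the chain starts;
    its limit normal is a hypothesis. Other angles use the slice through \<open>c\<close>.\<close>
  have "\<exists>y. F y \<in> K \<and> (\<forall>z. F z \<in> K \<longrightarrow> 0 \<le> Im ((z - y) * cis (- \<theta>))) \<and>
      limit_normal K (r / (2 * R)) (F y) (cos \<theta> *\<^sub>R f1 + sin \<theta> *\<^sub>R f2) (sin \<theta> *\<^sub>R f1 - cos \<theta> *\<^sub>R f2) \<and>
      (\<theta> = 0 \<longrightarrow> y = 0)" for \<theta>
  proof (cases "\<theta> = 0")
    case True
    then show ?thesis using x F0 by (intro exI[of _ 0]) (auto simp: F_def)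
  next
    case False
    define e w where "e = cos \<theta> *\<^sub>R f1 + sin \<theta> *\<^sub>R f2" and "w = sin \<theta> *\<^sub>R f1 - cos \<theta> *\<^sub>R f2"
    have "e \<bullet> e = 1" "w \<bullet> w = 1" "e \<bullet> w = 0"
      using sin_cos_squared_add3[of \<theta>] by (simp_all add: e_def w_def inner_simps ff mult.commute add.commute)
    then have ew: "norm e = 1" "norm w = 1" "e \<bullet> w = 0" by (simp_all add: norm_eq_sqrt_inner)
    \<comment> \<open>In these coordinates \<open>e\<close> is \<open>cis \<theta>\<close> and the
      outward direction \<open>w\<close> is \<open>- \<i> * cis \<theta>\<close>, whence the sign of
      \<open>b\<close>.\<close>
    have F: "c + a *\<^sub>R e + b *\<^sub>R w = F (cz + Complex a (- b) * cis \<theta>)" for a b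
      by (simp add: F_def c e_def w_def algebra_simps)
    obtain a b where ab: "c + a *\<^sub>R e + b *\<^sub>R w \<in> K"
      "\<And>a' b'. c + a' *\<^sub>R e + b' *\<^sub>R w \<in> K \<Longrightarrow> b' \<le> b"
      "limit_normal K (r / (2 * R)) (c + a *\<^sub>R e + b *\<^sub>R w) e w"
      using support_point_with_limit_normal[OF K ew] by blast
    define y where "y = cz + Complex a (- b) * cis \<theta>"
    have "0 \<le> Im ((z - y) * cis (- \<theta>))" if "F z \<in> K" for z
    proof -
      define q where "q = (z - cz) * cis (- \<theta>)"
      have "z = cz + q * cis \<theta>" by (simp add: q_def mult.assoc cis_mult)
      then have "F z = c + Re q *\<^sub>R e + (- Im q) *\<^sub>R w" unfolding F by (simp add: complex_surj)
      then have "- Im q \<le> b" using ab(2) that by metis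
      moreover have "(z - y) * cis (- \<theta>) = q - Complex a (- b)"
        unfolding q_def y_def by (simp add: algebra_simps cis_mult)
      ultimately show ?thesis by simp
    qed
    moreover have "F y \<in> K" "limit_normal K (r / (2 * R)) (F y) e w"
      using ab(1,3) unfolding F y_def by auto
    ultimately show ?thesis using False unfolding e_def w_def by blast
  qed
  then obtain Y where Y: "\<And>\<theta>. F (Y \<theta>) \<in> K" "\<And>\<theta> z. F z \<in> K \<Longrightarrow> 0 \<le> Im ((z - Y \<theta>) * cis (- \<theta>))"
      "\<And>\<theta>. limit_normal K (r / (2 * R)) (F (Y \<theta>)) (cos \<theta> *\<^sub>R f1 + sin \<theta> *\<^sub>R f2) (sin \<theta> *\<^sub>R f1 - cos \<theta> *\<^sub>R f2)"
      "Y 0 = 0"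
    by metis
  obtain a b where ab: "a \<bullet> v < b" "\<And>z. z \<in> F -` K \<Longrightarrow> b < a \<bullet> z"
    using separating_hyperplane_closed_point[OF convexL closedL vL] by blast
  \<comment> \<open>\<open>a\<close> points to the side of the slice; turning it clockwise by a
    right angle gives the direction of the separating line.\<close>
  define \<theta> where "\<theta> = Arg (- \<i> * a)"
  have "- \<i> * a = of_real (norm a) * cis \<theta>"
    using rcis_cmod_Arg[of "- \<i> * a"] by (simp add: \<theta>_def rcis_def norm_mult)
  then have "\<i> * (- \<i> * a) = \<i> * (of_real (norm a) * cis \<theta>)" by (rule arg_cong)
  then have a: "a = \<i> * (of_real (norm a) * cis \<theta>)" by (simp add: mult.assoc[symmetric])
  have inner_a: "a \<bullet> z = norm a * Im (z * cis (- \<theta>))" for z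
    by (subst a) (simp add: inner_complex_def algebra_simps)
  have "Im (Y \<theta> * cis (- \<theta>)) \<le> \<tau> * Im (mangled_vertex k n * cis (- \<theta>))"
  proof (rule support_point_below_vertex)
    show "\<bar>\<theta>\<bar> \<le> pi" using Arg_bounded[of "- \<i> * a"] unfolding \<theta>_def by linarith
    fix \<alpha> :: real
    have "(\<alpha> + pi / (2 * real k) - \<alpha>) / 2 = pi / (4 * real k)" by simp
    moreover have "0 \<le> sin (pi / (4 * real k))"
      using k(1) by (intro sin_ge_zero) (auto simp: field_simps)
    ultimately have "\<tau> \<le> dist (F (Y (\<alpha> + pi / (2 * real k)))) (F (Y \<alpha>))"
      using K k by (intro dist_limit_normals_ge[OF mod _ f Y(3) Y(3)]) auto
    then show "\<tau> \<le> norm (Y (\<alpha> + pi / (2 * real k)) - Y \<alpha>)" by (simp add: distF)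
  qed (use assms Y in auto)
  then have "a \<bullet> Y \<theta> \<le> a \<bullet> v"
    unfolding inner_a v by (intro mult_left_mono) auto
  then show False using ab(1) ab(2)[of "Y \<theta>"] Y(1)[of \<theta>] by simp
qed

section \<open>Orthonormal coordinates in two-dimensional subspaces\<close>

lemma subspace_direction_space:
  assumes "affine P" "P \<noteq> {}"
  shows "subspace (direction_space P)"
proof -
  obtain a where a: "a \<in> P" using assms(2) by blast
  have "direction_space P = (\<lambda>p. p - a) ` P"
  proof
    show "(\<lambda>p. p - a) ` P \<subseteq> direction_space P" using a by (auto simp: direction_space_def)
    show "direction_space P \<subseteq> (\<lambda>p. p - a) ` P"
    proof
      fix d assume "d \<in> direction_space P"
      then obtain p q where pq: "p \<in> P" "q \<in> P" "d = p - q" by (auto simp: direction_space_def)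
      have "a + 1 *\<^sub>R (p - q) \<in> P" using mem_affine_3_minus[OF assms(1) a pq(1,2)] .
      then show "d \<in> (\<lambda>p. p - a) ` P" using pq by force
    qed
  qed
  then show ?thesis using affine_diffs_subspace_subtract[OF assms(1) a] by simp
qed

text \<open>A vector outside the span of \<open>e1\<close> and \<open>e2\<close> would give three
  independent vectors in the span of a two-element basis.\<close>

lemma orthonormal_expansion_dim2:
  fixes e1 e2 :: "'a::real_inner"
  assumes "dim S = 2" "e1 \<in> S" "e2 \<in> S" "norm e1 = 1" "norm e2 = 1" "e1 \<bullet> e2 = 0" "v \<in> S"
  shows "v = (v \<bullet> e1) *\<^sub>R e1 + (v \<bullet> e2) *\<^sub>R e2"
proof -
  obtain B where B: "B \<subseteq> S" "independent B" "S \<subseteq> span B" "card B = 2"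
    using basis_exists[of S] assms(1) by metis
  have "finite B" using B(4) card.infinite by fastforce
  have ee: "e1 \<bullet> e1 = 1" "e2 \<bullet> e2 = 1" "e2 \<bullet> e1 = 0"
    using assms by (simp_all add: dot_square_norm inner_commute)
  have "e1 \<notin> span {e2}"
  proof
    assume "e1 \<in> span {e2}"
    then obtain t where "e1 = t *\<^sub>R e2" by (auto simp: span_singleton)
    then show False using assms(6) ee by (metis inner_scaleR_left mult.right_neutral mult_zero_left scaleR_zero_left zero_neq_one inner_zero_left)
  qed
  moreover have "e2 \<noteq> 0" using assms(5) by auto
  ultimately have ind: "independent {e1, e2}" "e1 \<noteq> e2"
    using independent_insertI[of e1 "{e2}"] span_base[of e2 "{e2}"] by (auto simp: dependent_single)
  have "v \<in> span {e1, e2}"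
  proof (rule ccontr)
    assume v: "v \<notin> span {e1, e2}"
    then have "independent {v, e1, e2}" using ind independent_insertI by blast
    then have "card {v, e1, e2} \<le> card B"
      using independent_span_bound[OF \<open>finite B\<close>, of "{v, e1, e2}"] assms B(3) by blast
    moreover have "v \<noteq> e1" "v \<noteq> e2" using v span_base[of _ "{e1, e2}"] by auto
    ultimately show False using B(4) ind(2) by simp
  qed
  then obtain s t where "v = s *\<^sub>R e1 + t *\<^sub>R e2"
    by (auto simp: span_insert span_singleton algebra_simps)
  then show ?thesis using assms(6) ee by (simp add: inner_simps)
qed

lemma orthonormal_basis_dim2_exists:
  fixes S :: "'a::real_inner set"
  assumes "subspace S" "dim S = 2"
  obtains e1 e2 where "e1 \<in> S" "e2 \<in> S" "norm e1 = 1" "norm e2 = 1" "e1 \<bullet> e2 = 0"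
proof -
  obtain B where B: "B \<subseteq> S" "independent B" "S \<subseteq> span B" "card B = 2"
    using basis_exists[of S] assms(2) by metis
  then obtain a b where ab: "B = {a, b}" "a \<noteq> b" by (meson card_2_iff)
  have a0: "a \<noteq> 0" using B(2) ab dependent_zero by blast
  define e where "e = a /\<^sub>R norm a"
  define d where "d = b - (b \<bullet> e) *\<^sub>R e"
  have e: "e \<in> S" "norm e = 1"
    using a0 B ab assms(1) by (auto simp: e_def subspace_scale)
  have "d \<noteq> 0"
  proof
    assume "d = 0"
    then have "b = ((b \<bullet> e) * inverse (norm a)) *\<^sub>R a" by (simp add: d_def e_def)
    then have "b \<in> span (B - {b})" using ab by (metis Diff_insert_absorb insert_commute insert_iff singletonD span_breakdown_eq span_scale span_base insertI1 insert_Diff_if)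
    then show False using B(2) ab dependent_def by blast
  qed
  have "d \<bullet> e = 0" using e(2) by (simp add: d_def inner_simps dot_square_norm)
  moreover have "d \<in> S" using B ab e assms(1) by (auto simp: d_def intro!: subspace_diff subspace_scale)
  ultimately show ?thesis
    using \<open>d \<noteq> 0\<close> e assms(1) that[of e "d /\<^sub>R norm d"] by (simp add: subspace_scale inner_commute)
qed

lemma orth_proj_orthonormal:
  fixes e1 e2 :: "'a::real_inner"
  assumes "subspace S" "dim S = 2" "e1 \<in> S" "e2 \<in> S" "norm e1 = 1" "norm e2 = 1" "e1 \<bullet> e2 = 0"
  shows "orth_proj S u = (u \<bullet> e1) *\<^sub>R e1 + (u \<bullet> e2) *\<^sub>R e2"
proof (rule orth_proj_eq[OF assms(1)])
  show "(u \<bullet> e1) *\<^sub>R e1 + (u \<bullet> e2) *\<^sub>R e2 \<in> S"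
    using assms by (intro subspace_add subspace_scale)
  fix s assume "s \<in> S"
  then have s: "s = (s \<bullet> e1) *\<^sub>R e1 + (s \<bullet> e2) *\<^sub>R e2"
    using orthonormal_expansion_dim2[OF assms(2-)] by blast
  have "e1 \<bullet> e1 = 1" "e2 \<bullet> e2 = 1" "e2 \<bullet> e1 = 0"
    using assms by (simp_all add: dot_square_norm inner_commute)
  then have "(u - ((u \<bullet> e1) *\<^sub>R e1 + (u \<bullet> e2) *\<^sub>R e2)) \<bullet> ((s \<bullet> e1) *\<^sub>R e1 + (s \<bullet> e2) *\<^sub>R e2) = 0"
    using assms(7) by (simp add: inner_simps)
  then show "orthogonal (u - ((u \<bullet> e1) *\<^sub>R e1 + (u \<bullet> e2) *\<^sub>R e2)) s"
    using s by (simp add: orthogonal_def)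
qed

text \<open>By the floor in \<open>k\<close>, half of the angle \<Phi> is at most
  \<open>pi / (4 * real k)\<close>; taking sines gives the inequality. The bound on \<phi> keeps
  \<Phi> small enough for \<open>k\<close> to be positive.\<close>

lemma sin_half_angle_le:
  fixes r R \<phi> :: real
  assumes "0 < r" "r < R" "0 < \<phi>" "\<phi> < 2 * arcsin (r / (4 * sqrt 2 * R))"
    and k: "k = nat \<lfloor>pi / (2 * (2 * arcsin (2 * R / r * sin (\<phi> / 2))))\<rfloor>"
  shows "0 < k" "sin (\<phi> / 2) \<le> r / (2 * R) * sin (pi / (4 * real k))" "\<phi> \<le> pi"
proof -
  have s2: "1 \<le> sqrt 2" by simp
  have "r * 1 \<le> R * (4 * sqrt 2)" using assms(1,2) s2 by (intro mult_mono) linarith+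
  then have q: "0 \<le> r / (4 * sqrt 2 * R)" "r / (4 * sqrt 2 * R) \<le> 1" using assms by (simp_all add: field_simps)
  then have "arcsin (r / (4 * sqrt 2 * R)) \<le> pi / 2" by (intro arcsin_ubound) auto
  then have \<phi>: "\<phi> / 2 < pi / 2" using assms by linarith
  then show "\<phi> \<le> pi" by simp
  have sp: "0 < sin (\<phi> / 2)" using assms \<phi> by (intro sin_gt_zero) auto
  have "sin (\<phi> / 2) < sin (arcsin (r / (4 * sqrt 2 * R)))"
    using assms \<phi> \<open>arcsin _ \<le> pi / 2\<close> by (intro sin_monotone_2pi) auto
  also have "\<dots> = r / (4 * sqrt 2 * R)" using q by (intro sin_arcsin) auto
  finally have "sin (\<phi> / 2) < r / (4 * sqrt 2 * R)" .
  then have "2 * R / r * sin (\<phi> / 2) < 2 * R / r * (r / (4 * sqrt 2 * R))"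
    using assms by (intro mult_strict_left_mono) auto
  also have "\<dots> = 1 / (2 * sqrt 2)" using assms by (simp add: field_simps)
  \<comment> \<open>The value 1/2 is chosen because its arcsine is \<open>pi / 6\<close>.\<close>
  also have "\<dots> \<le> 1 / 2" using s2 by (simp add: field_simps)
  finally have t: "2 * R / r * sin (\<phi> / 2) < 1 / 2" .
  define t where "t = 2 * R / r * sin (\<phi> / 2)"
  have t: "0 < t" "t < 1 / 2" using t sp assms by (simp_all add: t_def)
  have as: "0 < arcsin t" "arcsin t \<le> pi / 6"
    using t arcsin_less_arcsin[of 0 t] arcsin_le_arcsin[of t "1/2"] by auto
  have "1 \<le> pi / (2 * (2 * arcsin t))" using as by (simp add: field_simps)
  then have fl: "1 \<le> \<lfloor>pi / (2 * (2 * arcsin t))\<rfloor>" by (simp add: le_floor_iff)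
  then show k0: "0 < k" unfolding k t_def[symmetric] by linarith
  have "real k \<le> pi / (2 * (2 * arcsin t))"
    using fl unfolding k t_def[symmetric] by simp
  then have "arcsin t \<le> pi / (4 * real k)" using k0 as by (simp add: field_simps)
  moreover have "pi / (4 * real k) \<le> pi / 2" using k0 by (simp add: field_simps)
  ultimately have "sin (arcsin t) \<le> sin (pi / (4 * real k))"
    using as by (intro sin_monotone_2pi_le) auto
  then have "t \<le> sin (pi / (4 * real k))" using t by simp
  then show "sin (\<phi> / 2) \<le> r / (2 * R) * sin (pi / (4 * real k))"
    using assms by (simp add: t_def field_simps)
qed

theorem corollary10:
  fixes K :: "'a::{real_inner,complete_space} set" and c :: 'a and r R \<tau> \<phi> :: real
  assumes "convex_body K"
    and "c \<in> K" and "cball c r \<subseteq> K" and "K \<subseteq> cball c R"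
    and "0 < r" and "r < R"
    and "0 < \<tau>" and "\<tau> < 2 * r"
    and "0 < \<phi>" and "\<phi> < 2 * arcsin (r / (4 * sqrt 2 * R))"
    and "normal_modulus K \<tau> \<le> \<phi>"
  shows "\<forall>x u P. x \<in> frontier K \<and> u \<in> outer_normals K x \<and>
           affine_plane P \<and> x \<in> P \<and> c \<in> P \<longrightarrow>
           (let v = orth_proj (direction_space P) u;
                w = v /\<^sub>R norm v;
                \<Phi> = 2 * arcsin (2 * R / r * sin (\<phi> / 2))
            in v \<noteq> 0 \<and>
               (\<forall>b e1 e2 \<alpha>. cartesian_system P b e1 e2 \<and>
                  [\<alpha> = Arg (vec_coords e1 e2 w) + pi / 2] (rmod (2 * pi)) \<longrightarrow>
                  coords_point b e1 e2 `
                    mangled_polygon (point_coords b e1 e2 x) \<alpha> \<Phi> \<tau> \<subseteq> K))"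
proof (intro allI impI)
  fix x u P
  assume H: "x \<in> frontier K \<and> u \<in> outer_normals K x \<and> affine_plane P \<and> x \<in> P \<and> c \<in> P"
  define D where "D = direction_space P"
  have D: "subspace D" "dim D = 2"
    using H subspace_direction_space[of P] by (auto simp: D_def affine_plane_def)
  have diffD: "p - q \<in> D" if "p \<in> P" "q \<in> P" for p q
    using that by (auto simp: D_def direction_space_def)
  have K: "closed K" "convex K" using assms(1) by (simp_all add: convex_body_def)
  have xK: "x \<in> K" using H K(1) by (meson frontier_subset_closed subsetD)
  define v where "v = orth_proj D u"
  have v: "v \<in> D" "\<And>s. s \<in> D \<Longrightarrow> u \<bullet> s = v \<bullet> s"
  proof -
    obtain e1 e2 where e: "e1 \<in> D" "e2 \<in> D" "norm e1 = 1" "norm e2 = 1" "e1 \<bullet> e2 = 0"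
      using orthonormal_basis_dim2_exists[OF D] by blast
    have ve: "v = (u \<bullet> e1) *\<^sub>R e1 + (u \<bullet> e2) *\<^sub>R e2"
      unfolding v_def using orth_proj_orthonormal[OF D e] .
    then show "v \<in> D" using e D(1) by (simp add: subspace_add subspace_scale)
    fix s assume "s \<in> D"
    then have s: "s = (s \<bullet> e1) *\<^sub>R e1 + (s \<bullet> e2) *\<^sub>R e2"
      by (rule orthonormal_expansion_dim2[OF D(2) e])
    have "u \<bullet> s = (s \<bullet> e1) * (u \<bullet> e1) + (s \<bullet> e2) * (u \<bullet> e2)"
      by (subst s) (simp add: inner_simps)
    also have "\<dots> = v \<bullet> s" unfolding ve by (simp add: inner_simps inner_commute mult.commute)
    finally show "u \<bullet> s = v \<bullet> s" .
  qed
  \<comment> \<open>As \<open>x - c\<close> lies in the direction space, \<open>u\<close> may be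
    replaced by \<open>v\<close>; this gives \<open>norm v\<close> at least
    \<open>r / R\<close>.\<close>
  have "r \<le> (x - c) \<bullet> u"
    using inner_outer_normal_ge[OF assms(3)] assms(5) H by auto
  also have "\<dots> = (x - c) \<bullet> v"
    using v(2)[of "x - c"] diffD H by (simp add: inner_commute)
  also have "\<dots> \<le> norm (x - c) * norm v" by (rule norm_cauchy_schwarz)
  also have "\<dots> \<le> R * norm v"
    using xK assms(4) by (intro mult_right_mono) (auto simp: dist_norm norm_minus_commute)
  finally have rv: "r \<le> R * norm v" .
  have v0: "v \<noteq> 0" using rv assms(5) by auto
  define w where "w = v /\<^sub>R norm v"
  have w: "w \<in> D" "norm w = 1" "v = norm v *\<^sub>R w" using v(1) v0 D(1) by (simp_all add: w_def subspace_scale)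
  define k where "k = nat \<lfloor>pi / (2 * (2 * arcsin (2 * R / r * sin (\<phi> / 2))))\<rfloor>"
  note k = sin_half_angle_le[OF assms(5,6,9,10) k_def]
  have "coords_point b e1 e2 ` mangled_polygon (point_coords b e1 e2 x) \<alpha> (2 * arcsin (2 * R / r * sin (\<phi> / 2))) \<tau> \<subseteq> K"
    if cs: "cartesian_system P b e1 e2" and \<alpha>: "[\<alpha> = Arg (vec_coords e1 e2 w) + pi / 2] (rmod (2 * pi))"
    for b e1 e2 \<alpha>
  proof -
    have e: "e1 \<in> D" "e2 \<in> D" "norm e1 = 1" "norm e2 = 1" "e1 \<bullet> e2 = 0" and b: "b \<in> P"
      using cs by (auto simp: cartesian_system_def D_def orthogonal_def)
    have ee: "e1 \<bullet> e1 = 1" "e2 \<bullet> e2 = 1" "e2 \<bullet> e1 = 0" "e1 \<bullet> e2 = 0"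
      using e by (simp_all add: dot_square_norm inner_commute)
    note expand = orthonormal_expansion_dim2[OF D(2) e]
    have "(w \<bullet> e1)\<^sup>2 + (w \<bullet> e2)\<^sup>2 = w \<bullet> w"
      by (subst (3) expand[OF w(1)]) (simp add: inner_simps power2_eq_square)
    then have "norm (vec_coords e1 e2 w) = 1"
      using w(2) by (simp add: vec_coords_def cmod_def dot_square_norm)
    then have "cis (Arg (vec_coords e1 e2 w)) = vec_coords e1 e2 w"
      using rcis_cmod_Arg[of "vec_coords e1 e2 w"] by (simp add: rcis_def)
    then have "cis \<alpha> = \<i> * vec_coords e1 e2 w"
      using cis_cong[OF \<alpha>] by (simp add: cis_mult[symmetric] mult.commute)
    then have cs\<alpha>: "cos \<alpha> = - (w \<bullet> e2)" "sin \<alpha> = w \<bullet> e1"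
      by (simp_all add: complex_eq_iff vec_coords_def)
    \<comment> \<open>The coordinate axes turned by \<alpha>: \<open>f1\<close> is tangent to the
      supporting line at \<open>x\<close>, and \<open>f2\<close> is the inward direction
      \<open>- w\<close>.\<close>
    define f1 f2 where "f1 = cos \<alpha> *\<^sub>R e1 + sin \<alpha> *\<^sub>R e2" and "f2 = cos \<alpha> *\<^sub>R e2 - sin \<alpha> *\<^sub>R e1"
    have wf: "w = - f2" using expand[OF w(1)] by (simp add: f2_def cs\<alpha>)
    have fD: "f1 \<in> D" "f2 \<in> D" unfolding f1_def f2_def
      using e D(1) by (auto intro!: subspace_add subspace_diff subspace_scale)
    have "f1 \<bullet> f1 = 1" "f1 \<bullet> f2 = 0"
      using sin_cos_squared_add3[of \<alpha>] by (simp_all add: f1_def f2_def inner_simps ee)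
    then have f: "norm f1 = 1" "norm f2 = 1" "f1 \<bullet> f2 = 0"
      using w(2) wf by (simp_all add: norm_eq_sqrt_inner)
    have ff: "f2 \<bullet> f2 = 1" using f by (simp add: dot_square_norm)
    define F where "F = (\<lambda>z. x + Re z *\<^sub>R f1 + Im z *\<^sub>R f2)"
    have cF: "c = x + Re (Complex ((c - x) \<bullet> f1) ((c - x) \<bullet> f2)) *\<^sub>R f1
        + Im (Complex ((c - x) \<bullet> f1) ((c - x) \<bullet> f2)) *\<^sub>R f2"
    proof -
      have "c - x = ((c - x) \<bullet> f1) *\<^sub>R f1 + ((c - x) \<bullet> f2) *\<^sub>R f2"
        using orthonormal_expansion_dim2[OF D(2) fD f] diffD H by blast
      from arg_cong[OF this, of "(+) x"] show ?thesis by (simp add: add.assoc)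
    qed
    have uf: "u \<bullet> f1 = 0" "u \<bullet> f2 = - norm v"
    proof -
      have "u \<bullet> f1 = norm v * (w \<bullet> f1)" "u \<bullet> f2 = norm v * (w \<bullet> f2)"
        using v(2)[OF fD(1)] v(2)[OF fD(2)] w(3) by (metis inner_scaleR_left)+
      then show "u \<bullet> f1 = 0" "u \<bullet> f2 = - norm v" using f(3) ff by (simp_all add: wf inner_commute)
    qed
    have support: "0 \<le> Im z" if "x + Re z *\<^sub>R f1 + Im z *\<^sub>R f2 \<in> K" for z
    proof -
      have "(x + Re z *\<^sub>R f1 + Im z *\<^sub>R f2 - x) \<bullet> u \<le> 0"
        using that H unfolding outer_normals_def by blast
      then have "0 \<le> Im z * norm v"
        using uf by (simp add: inner_simps inner_commute)
      then show ?thesis using v0 by (simp add: zero_le_mult_iff)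
    qed
    have "r / (2 * R) < u \<bullet> (- f2)"
      using rv assms(5,6) uf(2) by (simp add: field_simps)
    \<comment> \<open>At \<open>x\<close> the pair \<open>x\<close>, \<open>u\<close> serves as
      witness for every distance.\<close>
    then have lim: "limit_normal K (r / (2 * R)) x f1 (- f2)"
      unfolding limit_normal_def using H uf(1) by (intro allI impI bexI[of _ x] bexI[of _ u]) auto
    have vertex: "F (\<tau> *\<^sub>R mangled_vertex k n) \<in> K" if "n < 4 * k" for n
      unfolding F_def
      using mangled_vertex_in_slice[OF K assms(3,4,5) _ assms(11,9) k(3) _ k(1,2) f cF xK support lim that refl]
        assms by simp
    have "convex {p. F (\<tau> *\<^sub>R p) \<in> K}"
    proof (rule convexI)
      fix p q and s t :: real
      assume *: "p \<in> {p. F (\<tau> *\<^sub>R p) \<in> K}" "q \<in> {p. F (\<tau> *\<^sub>R p) \<in> K}" "0 \<le> s" "0 \<le> t" "s + t = 1"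
      have "F (\<tau> *\<^sub>R (s *\<^sub>R p + t *\<^sub>R q)) = (1 - (s + t)) *\<^sub>R x + s *\<^sub>R F (\<tau> *\<^sub>R p) + t *\<^sub>R F (\<tau> *\<^sub>R q)"
        by (simp add: F_def algebra_simps)
      then show "s *\<^sub>R p + t *\<^sub>R q \<in> {p. F (\<tau> *\<^sub>R p) \<in> K}"
        using * convexD[OF K(2), of "F (\<tau> *\<^sub>R p)" "F (\<tau> *\<^sub>R q)" s t] by simp
    qed
    moreover have "mangled_vertex k ` ({1..4*k} - {k, 2*k, 3*k, 4*k}) \<subseteq> {p. F (\<tau> *\<^sub>R p) \<in> K}"
      using vertex by auto
    ultimately have hull: "mangled_polygon0 k \<subseteq> {p. F (\<tau> *\<^sub>R p) \<in> K}"
      unfolding mangled_polygon0_def by (rule hull_minimal[rotated])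
    \<comment> \<open>Rotating by \<alpha> and translating to \<open>x\<close> in the given system
      amounts to using the frame \<open>f1\<close>, \<open>f2\<close> at \<open>x\<close>.\<close>
    have "coords_point b e1 e2 (cis \<alpha> * (\<tau> *\<^sub>R p) + point_coords b e1 e2 x) = F (\<tau> *\<^sub>R p)" for p
    proof -
      have "x = b + ((x - b) \<bullet> e1) *\<^sub>R e1 + ((x - b) \<bullet> e2) *\<^sub>R e2"
        using expand[of "x - b"] diffD H b by (simp add: add.assoc)
      then show ?thesis
        by (simp add: F_def coords_point_def point_coords_def vec_coords_def f1_def f2_def algebra_simps)
    qed
    then show ?thesis
      using hull unfolding mangled_polygon_def k_def[symmetric] by auto
  qed
  then show "let v = orth_proj (direction_space P) u;
                w = v /\<^sub>R norm v;
                \<Phi> = 2 * arcsin (2 * R / r * sin (\<phi> / 2))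
            in v \<noteq> 0 \<and>
               (\<forall>b e1 e2 \<alpha>. cartesian_system P b e1 e2 \<and>
                  [\<alpha> = Arg (vec_coords e1 e2 w) + pi / 2] (rmod (2 * pi)) \<longrightarrow>
                  coords_point b e1 e2 `
                    mangled_polygon (point_coords b e1 e2 x) \<alpha> \<Phi> \<tau> \<subseteq> K)"
    using v0 unfolding Let_def D_def[symmetric] v_def[symmetric] w_def[symmetric] by blast
qed

end
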